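(* Let $g\in L^2(\mathbb R)$. The following are equivalent: (1) $(E_mT_ng)_{m,n\in\mathbb Z}$ is complete in $L^2(\mathbb R)$. (2) There is a measurable function $f(x,y):[0,1]\times[0,1]\to\mathbb C$, with $f_y\in L^2[0,1]$ for a.e. $y\in[0,1]$, satisfying: (a) for a.e. $y\in[0,1]$, $f_y\neq0$ a.e. on $[0,1]$; (b) for a.e. $y\in[0,1]$, $g(y+n)=\hat f_y(n)$ for all $n\in\mathbb Z$.
   Context: $T_cf(x)=f(x-c)$, $E_cf(x)=e^{2\pi icx}f(x)$. A family is complete in $L^2(\mathbb R)$ if its closed linear span is $L^2(\mathbb R)$ (complex scalars). For a function $f(x,y)$ of two variables, $f_y$ denotes the function $f_y(x)=f(x,y)$, and $\hat f_y(n)=\int_0^1 f_y(x)e^{-2\pi inx}\,dx$. *)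

theory Defs
  imports "HOL-Analysis.Analysis"
begin

text \<open>
  Elements of \<open>L\<^sup>2\<close> are represented by functions rather than by classes modulo a.e. equality.
\<close>

definition L2 :: "'a measure \<Rightarrow> ('a \<Rightarrow> complex) set" where
  "L2 M = {f \<in> borel_measurable M. integrable M (\<lambda>x. (cmod (f x))\<^sup>2)}"

text \<open>Meaningful only for members of \<open>L2 M\<close>: the integral of a non-integrable function is 0.\<close>

definition L2_dist :: "'a measure \<Rightarrow> ('a \<Rightarrow> complex) \<Rightarrow> ('a \<Rightarrow> complex) \<Rightarrow> real" where
  "L2_dist M f h = sqrt (LINT x|M. (cmod (f x - h x))\<^sup>2)"

definition L2_closed_span :: "'a measure \<Rightarrow> ('i \<Rightarrow> 'a \<Rightarrow> complex) \<Rightarrow> ('a \<Rightarrow> complex) set" where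
  "L2_closed_span M F =
     {h \<in> L2 M. \<forall>\<epsilon>>0. \<exists>I c. finite I \<and> L2_dist M h (\<lambda>x. \<Sum>i\<in>I. c i * F i x) < \<epsilon>}"

definition complete_in_L2 :: "'a measure \<Rightarrow> ('i \<Rightarrow> 'a \<Rightarrow> complex) \<Rightarrow> bool" where
  "complete_in_L2 M F \<longleftrightarrow> range F \<subseteq> L2 M \<and> L2_closed_span M F = L2 M"

definition transl :: "real \<Rightarrow> (real \<Rightarrow> complex) \<Rightarrow> real \<Rightarrow> complex" where
  "transl c f x = f (x - c)"

definition modul :: "real \<Rightarrow> (real \<Rightarrow> complex) \<Rightarrow> real \<Rightarrow> complex" where
  "modul c f x = exp (2 * of_real pi * \<i> * of_real (c * x)) * f x"

definition fourier_coeff :: "(real \<Rightarrow> complex) \<Rightarrow> int \<Rightarrow> complex" where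
  "fourier_coeff f n =
     (LINT x|lebesgue_on {0..1}. f x * exp (- (2 * of_real pi * \<i> * of_int n * of_real x)))"

end

theory Submission
  imports Defs
begin

text \<open>
  The Zak transform \<open>u(x, y) = \<Sum>\<^sub>n v(y + n) exp(2\<pi>inx)\<close> is an isometry \<open>v \<mapsto> u\<close> from \<open>L\<^sup>2(\<real>)\<close> onto
  \<open>L\<^sup>2([0,1]\<^sup>2)\<close> that turns \<open>E\<^sub>m T\<^sub>n\<close> into multiplication by \<open>exp(2\<pi>i(nx + my))\<close>, and condition (b) says
  that \<open>f\<close> is the Zak transform of \<open>g\<close>. The span of the system thus becomes the set of products
  \<open>p f\<close> with \<open>p\<close> a trigonometric polynomial. If \<open>f \<noteq> 0\<close> a.e., then for every \<open>u\<close> in \<open>L\<^sup>2([0,1]\<^sup>2)\<close> the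
  quotient \<open>u / f\<close> lies in \<open>L\<^sup>2(\<bar>f\<bar>\<^sup>2 dx dy)\<close>, where trigonometric polynomials are dense because the
  measure is finite; hence products \<open>p f\<close> approximate \<open>u\<close>. If \<open>f\<close> vanishes on a set of positive
  measure, the indicator of that set stays at a positive distance from all products \<open>p f\<close>.
\<close>

section \<open>Density in \<open>L\<^sup>2\<close>\<close>

text \<open>Two points need work. The weight \<open>|f|^2\<close> is an arbitrary integrable
  density, so Fourier density in L^2 of the square does not suffice: density is proved for every
  finite measure carried by \<open>[0,1)^2\<close>, by transporting the measure to the torus in C x
  C and using Stone-Weierstrass there. The half-open square is forced by the identification of 0 and
  1 on the circle. Secondly, the Zak transform of a given \<open>v\<close> must be measurable in
  both variables jointly, which a Riesz-Fischer argument for each \<open>y\<close> separately does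
  not give; one subsequence of partial sums that converges a.e. on the square does. Condition (2)
  asks for square integrability of the slices of \<open>f\<close> only; that of \<open>f\<close>
  itself is inherited from \<open>g\<close> by integrating Parseval over \<open>y\<close>. Norms are
  kept squared and \<open>ennreal\<close>-valued, so that Tonelli and Fatou apply without
  integrability conditions and membership in L^2 becomes finiteness. The Zak transform is developed
  for Borel functions; Lebesgue measurable ones are replaced by Borel versions at the end.\<close>

definition nsq :: "'a measure \<Rightarrow> ('a \<Rightarrow> complex) \<Rightarrow> ennreal" where
  "nsq M f = (\<integral>\<^sup>+x. ennreal ((cmod (f x))\<^sup>2) \<partial>M)"

text \<open>The right side exceeds \<open>(cmod a + cmod b)^2\<close> by
  \<open>(cmod a - cmod b)^2\<close>. The factor 2 is the price for doing without Minkowski's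
  inequality and square roots; constants do not matter for density.\<close>

lemma cmod_add_power2_le: "(cmod (a + b))\<^sup>2 \<le> 2 * (cmod a)\<^sup>2 + 2 * (cmod b)\<^sup>2"
proof -
  have "(cmod (a + b))\<^sup>2 \<le> (cmod a + cmod b)\<^sup>2"
    by (intro power_mono norm_triangle_ineq) auto
  also have "\<dots> \<le> 2 * (cmod a)\<^sup>2 + 2 * (cmod b)\<^sup>2"
    using zero_le_power2[of "cmod a - cmod b"] by (simp add: power2_eq_square algebra_simps)
  finally show ?thesis .
qed

lemma nsq_add:
  assumes [measurable]: "f \<in> borel_measurable M" "h \<in> borel_measurable M"
  shows "nsq M (\<lambda>x. f x + h x) \<le> 2 * nsq M f + 2 * nsq M h"
proof -
  have "nsq M (\<lambda>x. f x + h x) \<le>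
      (\<integral>\<^sup>+x. 2 * ennreal ((cmod (f x))\<^sup>2) + 2 * ennreal ((cmod (h x))\<^sup>2) \<partial>M)"
    unfolding nsq_def
  proof (intro nn_integral_mono)
    fix x
    have "ennreal ((cmod (f x + h x))\<^sup>2) \<le> ennreal (2 * (cmod (f x))\<^sup>2 + 2 * (cmod (h x))\<^sup>2)"
      by (intro ennreal_leI cmod_add_power2_le)
    then show "ennreal ((cmod (f x + h x))\<^sup>2) \<le> 2 * ennreal ((cmod (f x))\<^sup>2) + 2 * ennreal ((cmod (h x))\<^sup>2)"
      by (simp add: ennreal_plus ennreal_mult)
  qed
  also have "\<dots> = 2 * nsq M f + 2 * nsq M h"
    unfolding nsq_def by (simp add: nn_integral_add nn_integral_cmult)
  finally show ?thesis .
qed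

lemma nsq_diff:
  assumes [measurable]: "f \<in> borel_measurable M" "h \<in> borel_measurable M"
  shows "nsq M (\<lambda>x. f x - h x) \<le> 2 * nsq M f + 2 * nsq M h"
  using nsq_add[of f M "\<lambda>x. - h x"] by (simp add: nsq_def)

lemma nsq_cmult:
  assumes [measurable]: "f \<in> borel_measurable M"
  shows "nsq M (\<lambda>x. c * f x) = ennreal ((cmod c)\<^sup>2) * nsq M f"
  unfolding nsq_def by (simp add: norm_mult power_mult_distrib ennreal_mult nn_integral_cmult)

text \<open>Dominated convergence for the squared error; \<open>w\<close> dominates the errors
  \<open>q - U i\<close>, not the functions \<open>U i\<close>.\<close>

lemma nsq_tendsto_zero:
  fixes q :: "'a \<Rightarrow> complex"
  assumes [measurable]: "\<And>i. U i \<in> borel_measurable M" "q \<in> borel_measurable M" "w \<in> borel_measurable M"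
    and w: "nsq M w < \<infinity>"
    and lim: "AE x in M. (\<lambda>i. U i x) \<longlonglongrightarrow> q x"
    and le: "\<And>i. AE x in M. cmod (q x - U i x) \<le> cmod (w x)"
  shows "(\<lambda>i. nsq M (\<lambda>x. q x - U i x)) \<longlonglongrightarrow> 0"
proof -
  have "(\<lambda>i. \<integral>\<^sup>+x. ennreal ((cmod (q x - U i x))\<^sup>2) \<partial>M) \<longlonglongrightarrow> (\<integral>\<^sup>+x. 0 \<partial>M)"
  proof (rule nn_integral_dominated_convergence[where w="\<lambda>x. ennreal ((cmod (w x))\<^sup>2)"])
    show "(\<integral>\<^sup>+ x. ennreal ((cmod (w x))\<^sup>2) \<partial>M) < \<infinity>" using w by (simp add: nsq_def)
    show "AE x in M. ennreal ((cmod (q x - U j x))\<^sup>2) \<le> ennreal ((cmod (w x))\<^sup>2)" for j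
      using le[of j] by eventually_elim (intro ennreal_leI power_mono, auto)
    show "AE x in M. (\<lambda>i. ennreal ((cmod (q x - U i x))\<^sup>2)) \<longlonglongrightarrow> 0"
      using lim
    proof eventually_elim
      case (elim x)
      have "(\<lambda>i. ennreal ((cmod (q x - U i x))\<^sup>2)) \<longlonglongrightarrow> ennreal ((cmod (q x - q x))\<^sup>2)"
        by (intro tendsto_intros elim tendsto_ennrealI)
      then show ?case by simp
    qed
  qed measurable
  then show ?thesis by (simp add: nsq_def)
qed

text \<open>\<open>V\<close> is left abstract because the approximants used later are functions on C
  x C that are recognised only through their pullback to the square. Finiteness of the measure makes
  constants admissible majorants.\<close>

locale L2_approximation = finite_measure M for M :: "'a measure" +
  fixes V :: "('a \<Rightarrow> complex) set"
  assumes V_measurable: "p \<in> V \<Longrightarrow> p \<in> borel_measurable M"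
    and V_add: "p \<in> V \<Longrightarrow> p' \<in> V \<Longrightarrow> (\<lambda>x. p x + p' x) \<in> V"
    and V_cmult: "p \<in> V \<Longrightarrow> (\<lambda>x. c * p x) \<in> V"
begin

definition approximable :: "('a \<Rightarrow> complex) \<Rightarrow> bool" where
  "approximable q \<longleftrightarrow> q \<in> borel_measurable M \<and> (\<forall>\<epsilon>>0. \<exists>p\<in>V. nsq M (\<lambda>x. q x - p x) < \<epsilon>)"

lemma approximable_closed:
  assumes [measurable]: "q \<in> borel_measurable M"
    and ex: "\<And>\<epsilon>. \<epsilon> > 0 \<Longrightarrow> \<exists>r. approximable r \<and> nsq M (\<lambda>x. q x - r x) < \<epsilon>"
  shows "approximable q"
  unfolding approximable_def
proof (intro conjI allI impI)
  fix \<epsilon> :: ennreal assume "\<epsilon> > 0"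
  \<comment> \<open>A quarter, because \<open>nsq_add\<close> doubles each of the two
    errors.\<close>
  then have e: "\<epsilon> / 4 > 0"
    by (simp add: ennreal_zero_less_divide)
  obtain r where r: "approximable r" "nsq M (\<lambda>x. q x - r x) < \<epsilon> / 4" using ex[OF e] by auto
  then obtain p where p: "p \<in> V" "nsq M (\<lambda>x. r x - p x) < \<epsilon> / 4"
    using e by (auto simp: approximable_def)
  have [measurable]: "r \<in> borel_measurable M" "p \<in> borel_measurable M"
    using r p V_measurable by (auto simp: approximable_def)
  have "nsq M (\<lambda>x. q x - p x) = nsq M (\<lambda>x. (q x - r x) + (r x - p x))" by simp
  also have "\<dots> \<le> 2 * nsq M (\<lambda>x. q x - r x) + 2 * nsq M (\<lambda>x. r x - p x)"
    by (intro nsq_add) measurable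
  also have "\<dots> < 2 * (\<epsilon> / 4) + 2 * (\<epsilon> / 4)"
    by (intro add_strict_mono ennreal_mult_strict_left_mono r p) auto
  also have "\<dots> = (4 * \<epsilon>) / 4"
    by (simp add: ennreal_times_divide distrib_right[symmetric] flip: add_divide_distrib_ennreal)
  also have "\<dots> = \<epsilon>" by (simp add: ennreal_mult_divide_eq mult.commute)
  finally show "\<exists>p\<in>V. nsq M (\<lambda>x. q x - p x) < \<epsilon>" using p by auto
qed measurable

lemma approximable_V: "p \<in> V \<Longrightarrow> approximable p"
  unfolding approximable_def using V_measurable by (auto intro!: bexI[of _ p] simp: nsq_def)

lemma approximable_add:
  assumes q: "approximable q" and r: "approximable r"
  shows "approximable (\<lambda>x. q x + r x)"
  unfolding approximable_def
proof (intro conjI allI impI)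
  have m[measurable]: "q \<in> borel_measurable M" "r \<in> borel_measurable M"
    using q r by (auto simp: approximable_def)
  show "(\<lambda>x. q x + r x) \<in> borel_measurable M" by measurable
  fix \<epsilon> :: ennreal assume "\<epsilon> > 0"
  then have e: "\<epsilon> / 4 > 0"
    by (simp add: ennreal_zero_less_divide)
  obtain p where p: "p \<in> V" "nsq M (\<lambda>x. q x - p x) < \<epsilon> / 4"
    using q e by (auto simp: approximable_def)
  obtain p' where p': "p' \<in> V" "nsq M (\<lambda>x. r x - p' x) < \<epsilon> / 4"
    using r e by (auto simp: approximable_def)
  have [measurable]: "p' \<in> borel_measurable M" "p \<in> borel_measurable M"
    using p p' V_measurable by auto
  have "nsq M (\<lambda>x. q x + r x - (p x + p' x)) = nsq M (\<lambda>x. (q x - p x) + (r x - p' x))"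
    by (simp add: algebra_simps)
  also have "\<dots> \<le> 2 * nsq M (\<lambda>x. q x - p x) + 2 * nsq M (\<lambda>x. r x - p' x)"
    by (intro nsq_add) measurable
  also have "\<dots> < 2 * (\<epsilon> / 4) + 2 * (\<epsilon> / 4)"
    by (intro add_strict_mono ennreal_mult_strict_left_mono p p') auto
  also have "\<dots> = (4 * \<epsilon>) / 4"
    by (simp add: ennreal_times_divide distrib_right[symmetric] flip: add_divide_distrib_ennreal)
  also have "\<dots> = \<epsilon>" by (simp add: ennreal_mult_divide_eq mult.commute)
  finally show "\<exists>p\<in>V. nsq M (\<lambda>x. q x + r x - p x) < \<epsilon>" using p p' V_add by (intro bexI[of _ "\<lambda>x. p x + p' x"]) auto
qed

lemma approximable_cmult:
  assumes q: "approximable q"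
  shows "approximable (\<lambda>x. c * q x)"
  unfolding approximable_def
proof (intro conjI allI impI)
  have m[measurable]: "q \<in> borel_measurable M"
    using q by (auto simp: approximable_def)
  show "(\<lambda>x. c * q x) \<in> borel_measurable M" by measurable
  fix \<epsilon> :: ennreal assume "\<epsilon> > 0"
  \<comment> \<open>The summand 1 keeps the divisor positive when \<open>c = 0\<close>.\<close>
  define d where "d = 1 + (cmod c)\<^sup>2"
  have d: "d > 0" "(cmod c)\<^sup>2 \<le> d" unfolding d_def by (auto simp: add_pos_nonneg)
  have "\<epsilon> / ennreal d > 0"
    using \<open>\<epsilon> > 0\<close> d by (simp add: ennreal_zero_less_divide less_top)
  then obtain p where p: "p \<in> V" "nsq M (\<lambda>x. q x - p x) < \<epsilon> / ennreal d"
    using q by (auto simp: approximable_def)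
  have [measurable]: "p \<in> borel_measurable M"
    using p V_measurable by auto
  have "nsq M (\<lambda>x. c * q x - c * p x) = nsq M (\<lambda>x. c * (q x - p x))" by (simp add: algebra_simps)
  also have "\<dots> \<le> ennreal d * nsq M (\<lambda>x. q x - p x)"
    by (subst nsq_cmult) (auto intro!: mult_right_mono ennreal_leI d)
  also have "\<dots> < ennreal d * (\<epsilon> / ennreal d)"
    by (intro ennreal_mult_strict_left_mono p) (use d in auto)
  also have "\<dots> = \<epsilon>" using d by (simp add: ennreal_times_divide ennreal_mult_divide_eq mult.commute)
  finally show "\<exists>p\<in>V. nsq M (\<lambda>x. c * q x - p x) < \<epsilon>" using p V_cmult by (intro bexI[of _ "\<lambda>x. c * p x"]) auto
qed

text \<open>Dominated convergence followed by closedness of the class. The pointwise limits taken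
  below, of increasing sequences, of finite disjoint unions and of cutoff functions, all use
  it.\<close>

lemma approximable_limit:
  assumes U: "\<And>i. approximable (U i)" and [measurable]: "q \<in> borel_measurable M" "w \<in> borel_measurable M"
    and w: "nsq M w < \<infinity>"
    and lim: "AE x in M. (\<lambda>i. U i x) \<longlonglongrightarrow> q x"
    and le: "\<And>i. AE x in M. cmod (q x - U i x) \<le> cmod (w x)"
  shows "approximable q"
proof (rule approximable_closed)
  fix \<epsilon> :: ennreal assume "\<epsilon> > 0"
  have "(\<lambda>i. nsq M (\<lambda>x. q x - U i x)) \<longlonglongrightarrow> 0"
    using U by (intro nsq_tendsto_zero[OF _ _ _ w lim le]) (auto simp: approximable_def)
  then have "eventually (\<lambda>i. nsq M (\<lambda>x. q x - U i x) < \<epsilon>) sequentially"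
    using \<open>\<epsilon> > 0\<close> by (rule order_tendstoD)
  then obtain i where "nsq M (\<lambda>x. q x - U i x) < \<epsilon>" by (auto simp: eventually_sequentially)
  then show "\<exists>r. approximable r \<and> nsq M (\<lambda>x. q x - r x) < \<epsilon>" using U by auto
qed measurable

lemma nsq_const_finite: "nsq M (\<lambda>_. c) < \<infinity>"
  by (simp add: nsq_def ennreal_mult_less_top less_top[symmetric] emeasure_finite ennreal_mult_eq_top_iff)

end

text \<open>Measurable induction from indicators to nonnegative functions, then positive and
  negative parts of the real and imaginary parts. Finiteness of the norm belongs to the induction
  statement because the limit step uses the limit function as its own majorant.\<close>

lemma (in L2_approximation) approximable_of_indicators:
  assumes ind: "\<And>A. A \<in> sets M \<Longrightarrow> approximable (\<lambda>x. of_real (indicator A x))"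
    and [measurable]: "q \<in> borel_measurable M" and q: "nsq M q < \<infinity>"
  shows "approximable q"
proof -
  have nonneg: "nsq M (\<lambda>x. of_real (u x)) < \<infinity> \<Longrightarrow> approximable (\<lambda>x. of_real (u x))"
    if "u \<in> borel_measurable M" "\<And>x. 0 \<le> u x" for u :: "'a \<Rightarrow> real"
    using that
  proof (induction rule: borel_measurable_induct_real)
    case (set A) then show ?case using ind by simp
  next
    case (mult u c)
    show ?case
    \<comment> \<open>For \<open>c = 0\<close> a finite norm of \<open>c * u\<close> says nothing
      about \<open>u\<close>, so the induction hypothesis cannot be applied.\<close>
    proof (cases "c = 0")
      case True
      have "approximable (\<lambda>x. 0 * of_real (indicator {} x))"
        by (intro approximable_cmult ind) auto
      with True show ?thesis by simp
    next
      case False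
      have "nsq M (\<lambda>x. of_real (u x)) = nsq M (\<lambda>x. of_real (1/c) * of_real (c * u x))"
        using False by simp
      also have "\<dots> < \<infinity>"
        using mult by (subst nsq_cmult) (auto simp: ennreal_mult_less_top)
      finally have "approximable (\<lambda>x. of_real c * of_real (u x))"
        using mult by (intro approximable_cmult) auto
      then show ?thesis by simp
    qed
  next
    case (add u v)
    have "nsq M (\<lambda>x. of_real (u x)) \<le> nsq M (\<lambda>x. of_real (v x + u x))"
        "nsq M (\<lambda>x. of_real (v x)) \<le> nsq M (\<lambda>x. of_real (v x + u x))"
      unfolding nsq_def norm_of_real using add by (auto intro!: nn_integral_mono ennreal_leI power_mono)
    then show ?case
      using add by (auto intro!: approximable_add)
  next
    case (seq U)
    have Ule: "U i x \<le> u x" if "x \<in> space M" for i x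
      using seq that by (intro incseq_le[of "\<lambda>i. U i x"]) (auto simp: mono_def le_fun_def)
    have [measurable]: "U i \<in> borel_measurable M" for i using seq by auto
    have [measurable]: "u \<in> borel_measurable M"
      by (rule borel_measurable_LIMSEQ_real[of _ U]) (use seq in auto)
    show ?case
    proof (rule approximable_limit[where U="\<lambda>i x. of_real (U i x)" and w="\<lambda>x. of_real (u x)"])
      show "approximable (\<lambda>x. of_real (U i x))" for i
      proof -
        have "nsq M (\<lambda>x. of_real (U i x)) \<le> nsq M (\<lambda>x. of_real (u x))"
          unfolding nsq_def norm_of_real using Ule seq(2)
          by (intro nn_integral_mono ennreal_leI power_mono) (auto intro!: order_trans[OF Ule abs_ge_self])
        then show ?thesis using seq by auto
      qed
      show "AE x in M. (\<lambda>i. complex_of_real (U i x)) \<longlonglongrightarrow> complex_of_real (u x)"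
        using seq by (auto intro!: AE_I2 tendsto_intros)
      show "AE x in M. cmod (complex_of_real (u x) - complex_of_real (U i x)) \<le> cmod (complex_of_real (u x))" for i
      proof (intro AE_I2)
        fix x assume "x \<in> space M"
        then have "0 \<le> U i x" "U i x \<le> u x" using seq Ule by auto
        then show "cmod (complex_of_real (u x) - complex_of_real (U i x)) \<le> cmod (complex_of_real (u x))"
          by (simp flip: of_real_diff)
      qed
    qed (use seq in auto)
  qed
  have part: "approximable (\<lambda>x. of_real (max 0 (u x)))"
    if [measurable]: "u \<in> borel_measurable M" and "\<And>x. \<bar>u x\<bar> \<le> cmod (q x)" for u :: "'a \<Rightarrow> real"
  proof (rule nonneg)
    have "nsq M (\<lambda>x. of_real (max 0 (u x))) \<le> nsq M q"
      unfolding nsq_def norm_of_real using that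
      by (intro nn_integral_mono ennreal_leI power_mono) (auto intro!: order_trans[OF _ that(2)])
    then show "nsq M (\<lambda>x. of_real (max 0 (u x))) < \<infinity>" using q by auto
  qed auto
  let ?p = "\<lambda>x. of_real (max 0 (Re (q x))) + (-1) * of_real (max 0 (- Re (q x)))
      + \<i> * (of_real (max 0 (Im (q x))) + (-1) * of_real (max 0 (- Im (q x)))) :: complex"
  have "approximable ?p"
    by (intro approximable_add approximable_cmult part)
       (auto simp: abs_Re_le_cmod abs_Im_le_cmod)
  also have "?p = q"
    by (auto simp: fun_eq_iff complex_eq_iff max_def)
  finally show ?thesis .
qed

text \<open>Dynkin's pi-lambda argument. \<open>UNIV \<in> G\<close> supplies the constants needed
  for complements, and for disjoint unions the constant 1 is a square integrable majorant since the
  measure is finite.\<close>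

lemma (in L2_approximation) approximable_indicator_of_generator:
  assumes sets[measurable_cong]: "sets M = sigma_sets UNIV G" "space M = UNIV" and G: "Int_stable G" "UNIV \<in> G"
    and ind: "\<And>A. A \<in> G \<Longrightarrow> approximable (\<lambda>x. of_real (indicator A x))"
    and A: "A \<in> sets M"
  shows "approximable (\<lambda>x. of_real (indicator A x))"
proof -
  have A': "A \<in> sigma_sets UNIV G" using A sets by simp
  have "G \<subseteq> Pow UNIV" by auto
  from G(1) this A' show ?thesis
  proof (induction rule: sigma_sets_induct_disjoint)
    case (basic A) then show ?case using ind by auto
  next
    case empty
    have "approximable (\<lambda>x. 0 * of_real (indicator UNIV x))"
      using G by (intro approximable_cmult ind) auto
    then show ?case by simp
  next
    case (compl A)
    have "approximable (\<lambda>x. of_real (indicator UNIV x) + (-1) * of_real (indicator A x))"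
      using G compl by (intro approximable_add approximable_cmult ind[of UNIV]) auto
    also have "\<dots> = (\<lambda>x. of_real (indicator (UNIV - A) x))"
      by (auto simp: fun_eq_iff indicator_def)
    finally show ?case .
  next
    case (union A)
    have [measurable]: "A i \<in> sets M" for i using union sets by auto
    have fin: "approximable (\<lambda>x. \<Sum>i<n. of_real (indicator (A i) x))" for n
    proof (induction n)
      case 0
      have "approximable (\<lambda>x. 0 * of_real (indicator UNIV x))"
        using G by (intro approximable_cmult ind) auto
      then show ?case by simp
    next
      case (Suc n) then show ?case using union by (auto intro!: approximable_add)
    qed
    have sum: "(\<Sum>i<n. of_real (indicator (A i) x)) = (of_real (indicator (\<Union>i<n. A i) x) :: complex)" for n x
      using union(1) by (subst indicator_UN_disjoint) (auto simp: disjoint_family_on_def)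
    show ?case
    proof (rule approximable_limit[where w="\<lambda>_. 1", OF fin _ _ nsq_const_finite])
      show "AE x in M. (\<lambda>n. \<Sum>i<n. of_real (indicator (A i) x)) \<longlonglongrightarrow> complex_of_real (indicator (\<Union> (range A)) x)"
        unfolding sum by (intro AE_I2 tendsto_of_real LIMSEQ_indicator_UN)
      show "AE x in M. cmod (complex_of_real (indicator (\<Union> (range A)) x) - (\<Sum>i<n. of_real (indicator (A i) x))) \<le> cmod 1" for n
        unfolding sum by (intro AE_I2) (auto simp: indicator_def)
    qed measurable
  qed
qed

text \<open>Stone-Weierstrass on the compact carrier \<open>K\<close> gives the continuous
  functions, cutoffs of the distance give closed sets, and closed sets form an intersection-stable
  generator of the Borel sets. Errors off \<open>K\<close> are invisible to the measure.\<close>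

lemma approximable_of_polynomials:
  fixes q :: "'b::euclidean_space \<Rightarrow> complex"
  assumes "L2_approximation N V"
    and sets[measurable_cong]: "sets N = sets borel" and K: "compact K" "AE x in N. x \<in> K"
    and poly: "\<And>p. real_polynomial_function p \<Longrightarrow> (\<lambda>x. of_real (p x)) \<in> V"
    and q: "q \<in> borel_measurable borel" "nsq N q < \<infinity>"
  shows "L2_approximation.approximable N V q"
proof -
  interpret L2_approximation N V by fact
  have space: "space N = UNIV" using sets_eq_imp_space_eq[OF sets] by simp
  have cont: "approximable (\<lambda>x. of_real (h x))" if h: "continuous_on UNIV h" for h :: "'b \<Rightarrow> real"
  proof (rule approximable_closed)
    have [measurable]: "h \<in> borel_measurable borel" using h by (rule borel_measurable_continuous_onI)
    show "(\<lambda>x. complex_of_real (h x)) \<in> borel_measurable N" by measurable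
    fix \<epsilon> :: ennreal assume "\<epsilon> > 0"
    \<comment> \<open>Choosing \<open>d\<close> from this limit avoids dividing by the total mass,
      which may be 0.\<close>
    have "((\<lambda>d. ennreal (d\<^sup>2) * emeasure N (space N)) \<longlongrightarrow> ennreal (0\<^sup>2) * emeasure N (space N)) (at_right 0)"
      by (intro tendsto_mult_ennreal tendsto_ennrealI tendsto_intros) (simp add: emeasure_finite less_top)
    then have "eventually (\<lambda>d. ennreal (d\<^sup>2) * emeasure N (space N) < \<epsilon>) (at_right 0)"
      by (rule order_tendstoD) (use \<open>\<epsilon> > 0\<close> in simp)
    then obtain b where b: "b > 0" "\<And>d. 0 < d \<Longrightarrow> d < b \<Longrightarrow> ennreal (d\<^sup>2) * emeasure N (space N) < \<epsilon>"
      by (auto simp: eventually_at_right_field)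
    define d where "d = b / 2"
    have d: "d > 0" "ennreal (d\<^sup>2) * emeasure N (space N) < \<epsilon>" using b by (auto simp: d_def)
    obtain p where p: "real_polynomial_function p" "\<And>x. x \<in> K \<Longrightarrow> \<bar>h x - p x\<bar> < d"
      using Stone_Weierstrass_real_polynomial_function[OF K(1) continuous_on_subset[OF h] d(1)] by auto
    have "nsq N (\<lambda>x. of_real (h x) - of_real (p x)) \<le> (\<integral>\<^sup>+x. ennreal (d\<^sup>2) \<partial>N)"
      unfolding nsq_def using K(2)
    proof (intro nn_integral_mono_AE, eventually_elim)
      fix x assume "x \<in> K"
      then show "ennreal ((cmod (of_real (h x) - of_real (p x)))\<^sup>2) \<le> ennreal (d\<^sup>2)"
        using p(2)[of x] by (intro ennreal_leI power_mono) (simp_all flip: of_real_diff)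
    qed
    also have "\<dots> < \<epsilon>" using d by simp
    finally show "\<exists>r. approximable r \<and> nsq N (\<lambda>x. of_real (h x) - r x) < \<epsilon>"
      using poly[OF p(1)] approximable_V by blast
  qed
  have closed: "approximable (\<lambda>x. of_real (indicator C x))" if "closed C" for C :: "'b set"
  \<comment> \<open>\<open>infdist x {}\<close> is 0 by convention, so for the empty set the cutoffs
    below would tend to 1 instead of 0.\<close>
  proof (cases "C = {}")
    case True
    then show ?thesis using cont[of "\<lambda>_. 0"] by simp
  next
    case False
    have [measurable]: "C \<in> sets borel" using that by simp
    show ?thesis
    \<comment> \<open>The cutoffs are 1 on \<open>C\<close>, and vanish at a given point off
      \<open>C\<close> once \<open>i\<close> reaches the reciprocal of its distance, which is
      positive because \<open>C\<close> is closed.\<close>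
    proof (rule approximable_limit[where U="\<lambda>i x. of_real (max 0 (1 - real i * infdist x C))" and w="\<lambda>_. 1",
          OF cont _ _ nsq_const_finite])
      show "continuous_on UNIV (\<lambda>x. max 0 (1 - real i * infdist x C))" for i
        by (intro continuous_intros)
      have "(\<lambda>i. max 0 (1 - real i * infdist x C)) \<longlonglongrightarrow> indicator C x" for x
      proof (cases "x \<in> C")
        case True then show ?thesis by simp
      next
        case F: False
        then have pos: "infdist x C > 0"
          using that False infdist_pos_not_in_closed by blast
        have "eventually (\<lambda>i. max 0 (1 - real i * infdist x C) = indicator C x) sequentially"
        proof (rule eventually_mono[OF eventually_ge_at_top[of "nat \<lceil>1 / infdist x C\<rceil>"]])
          fix i assume "nat \<lceil>1 / infdist x C\<rceil> \<le> i"
          then have "1 / infdist x C \<le> real i" by linarith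
          then have "1 \<le> real i * infdist x C" using pos by (simp add: field_simps)
          then show "max 0 (1 - real i * infdist x C) = indicator C x" using F by simp
        qed
        then show ?thesis by (rule tendsto_eventually)
      qed
      then show "AE x in N. (\<lambda>i. complex_of_real (max 0 (1 - real i * infdist x C))) \<longlonglongrightarrow> of_real (indicator C x)"
        by (intro AE_I2 tendsto_of_real)
      show "AE x in N. cmod (of_real (indicator C x) - complex_of_real (max 0 (1 - real i * infdist x C))) \<le> cmod 1" for i
      proof (intro AE_I2)
        fix x
        have "\<bar>indicator C x - max 0 (1 - real i * infdist x C)\<bar> \<le> 1"
          using infdist_nonneg[of x C] by (auto simp: indicator_def max_def)
        then show "cmod (of_real (indicator C x) - complex_of_real (max 0 (1 - real i * infdist x C))) \<le> cmod 1"
          by (simp flip: of_real_diff)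
      qed
    qed measurable
  qed
  show ?thesis
  proof (rule approximable_of_indicators[OF _ _ q(2)])
    show "q \<in> borel_measurable N" using q(1) sets measurable_cong_sets by blast
    show "approximable (\<lambda>x. of_real (indicator A x))" if "A \<in> sets N" for A
    proof (rule approximable_indicator_of_generator[OF _ _ _ _ _ that, of "Collect closed"])
      show "sets N = sigma_sets UNIV (Collect closed)"
        unfolding sets borel_eq_closed by simp
      show "Int_stable (Collect (closed :: 'b set \<Rightarrow> bool))" by (auto simp: Int_stable_def)
    qed (use space closed in auto)
  qed
qed

section \<open>Finite linear combinations of a family\<close>

definition lin_span :: "('i \<Rightarrow> 'a \<Rightarrow> complex) \<Rightarrow> ('a \<Rightarrow> complex) set" where
  "lin_span F = {\<lambda>x. \<Sum>i\<in>I. c i * F i x |I c. finite I}"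

lemma bex_lin_span_iff:
  "(\<exists>s\<in>lin_span F. P s) \<longleftrightarrow> (\<exists>I c. finite I \<and> P (\<lambda>x. \<Sum>i\<in>I. c i * F i x))"
  unfolding lin_span_def by blast

lemma lin_spanI:
  assumes "finite I" "\<And>x. h x = (\<Sum>i\<in>I. c i * F i x)"
  shows "h \<in> lin_span F"
proof -
  have "h = (\<lambda>x. \<Sum>i\<in>I. c i * F i x)" using assms(2) by (rule ext)
  with assms(1) show ?thesis by (auto simp: lin_span_def)
qed

lemma lin_span_base: "F i \<in> lin_span F"
  by (rule lin_spanI[of "{i}" _ "\<lambda>_. 1"]) auto

lemma lin_span_cmult:
  assumes "h \<in> lin_span F"
  shows "(\<lambda>x. a * h x) \<in> lin_span F"
proof -
  obtain I c where "finite I" "h = (\<lambda>x. \<Sum>i\<in>I. c i * F i x)" using assms unfolding lin_span_def by blast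
  then show ?thesis
    by (intro lin_spanI[of I _ "\<lambda>i. a * c i"]) (auto simp: sum_distrib_left mult.assoc)
qed

text \<open>Coefficients are extended by zero to the union of the index sets, which may
  overlap.\<close>

lemma lin_span_add:
  assumes "h \<in> lin_span F" "h' \<in> lin_span F"
  shows "(\<lambda>x. h x + h' x) \<in> lin_span F"
proof -
  obtain I c where h: "finite I" "h = (\<lambda>x. \<Sum>i\<in>I. c i * F i x)" using assms unfolding lin_span_def by blast
  obtain I' c' where h': "finite I'" "h' = (\<lambda>x. \<Sum>i\<in>I'. c' i * F i x)" using assms unfolding lin_span_def by blast
  have "h x + h' x = (\<Sum>i\<in>I \<union> I'. ((if i \<in> I then c i else 0) + (if i \<in> I' then c' i else 0)) * F i x)" for x
  proof -
    have "h x = (\<Sum>i\<in>I \<union> I'. (if i \<in> I then c i else 0) * F i x)"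
      unfolding h using h h' by (intro sum.mono_neutral_cong_left) auto
    moreover have "h' x = (\<Sum>i\<in>I \<union> I'. (if i \<in> I' then c' i else 0) * F i x)"
      unfolding h' using h h' by (intro sum.mono_neutral_cong_left) auto
    ultimately show ?thesis by (simp add: distrib_right sum.distrib)
  qed
  then show ?thesis by (intro lin_spanI[of "I \<union> I'"]) (use h h' in auto)
qed

lemma lin_span_induct [consumes 1, case_names zero add]:
  assumes "h \<in> lin_span F"
    and zero: "P (\<lambda>_. 0)"
    and add: "\<And>h a i. P h \<Longrightarrow> P (\<lambda>x. a * F i x + h x)"
  shows "P h"
proof -
  obtain I c where I: "finite I" "h = (\<lambda>x. \<Sum>i\<in>I. c i * F i x)" using assms unfolding lin_span_def by blast
  have "P (\<lambda>x. \<Sum>i\<in>I. c i * F i x)" using I(1)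
  proof (induction rule: finite_induct)
    case empty then show ?case using zero by simp
  next
    case (insert i I)
    then show ?case using add[OF insert.IH, of "c i" i] by simp
  qed
  then show ?thesis by (simp add: I)
qed

section \<open>Trigonometric polynomials\<close>

text \<open>The character of R with period 1, often written e(t). The exponentials in
  \<open>modul\<close> and \<open>fourier_coeff\<close> are instances with a linear
  argument.\<close>

definition chr :: "real \<Rightarrow> complex" where
  "chr t = exp (2 * of_real pi * \<i> * of_real t)"

lemma chr_eq_cis: "chr t = cis (2 * pi * t)"
  unfolding chr_def cis_conv_exp by (simp add: mult_ac)

lemma cmod_chr [simp]: "cmod (chr t) = 1"
  by (simp add: chr_eq_cis)

lemma chr_0 [simp]: "chr 0 = 1"
  by (simp add: chr_def)

lemma chr_add: "chr (s + t) = chr s * chr t"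
  by (simp add: chr_eq_cis cis_mult ring_distribs)

lemma cnj_chr: "cnj (chr t) = chr (- t)"
  by (simp add: chr_eq_cis cis_cnj)

lemma chr_of_int [simp]: "chr (of_int n) = 1"
  using cis_multiple_2pi[of "of_int n"] by (simp add: chr_eq_cis)

lemma isCont_chr: "isCont chr t"
  unfolding chr_def by (intro continuous_intros)

lemma continuous_on_chr: "continuous_on A chr"
  by (simp add: continuous_at_imp_continuous_on isCont_chr)

lemma measurable_chr [measurable]: "chr \<in> borel_measurable borel"
  by (intro borel_measurable_continuous_onI continuous_on_chr)

text \<open>Inverts \<open>chr\<close> on one period; the interval is half-open because
  \<open>chr 0 = chr 1\<close>.\<close>

lemma Arg2pi_chr: "0 \<le> t \<Longrightarrow> t < 1 \<Longrightarrow> Arg2pi (chr t) = 2 * pi * t"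
  unfolding chr_def by (subst Arg2pi_exp) auto

text \<open>\<open>Arg2pi\<close> jumps across the positive real axis, but its sublevel sets are
  closed.\<close>

lemma measurable_Arg2pi [measurable]: "Arg2pi \<in> borel_measurable borel"
  unfolding borel_measurable_iff_le by (auto intro!: borel_closed closed_Arg2pi2pi_le)

text \<open>An inductive definition instead of finite sums: products, slices and Zak transforms are
  then treated by rule induction, without bookkeeping of index sets.\<close>

inductive trig_poly :: "(real \<times> real \<Rightarrow> complex) \<Rightarrow> bool" where
  char: "trig_poly (\<lambda>(x, y). chr (of_int m * x) * chr (of_int k * y))"
| add: "trig_poly p \<Longrightarrow> trig_poly p' \<Longrightarrow> trig_poly (\<lambda>z. p z + p' z)"
| cmult: "trig_poly p \<Longrightarrow> trig_poly (\<lambda>z. c * p z)"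

lemma trig_poly_mult_char:
  "trig_poly p \<Longrightarrow> trig_poly (\<lambda>z. (case z of (x, y) \<Rightarrow> chr (of_int m * x) * chr (of_int k * y)) * p z)"
proof (induction rule: trig_poly.induct)
  case (char m' k')
  have "(\<lambda>z. (case z of (x, y) \<Rightarrow> chr (of_int m * x) * chr (of_int k * y)) *
        (case z of (x, y) \<Rightarrow> chr (of_int m' * x) * chr (of_int k' * y))) =
      (\<lambda>(x, y). chr (of_int (m + m') * x) * chr (of_int (k + k') * y))"
    by (auto simp: fun_eq_iff chr_add ring_distribs)
  then show ?case by (metis trig_poly.char)
next
  case (add p p')
  then show ?case by (simp add: distrib_left trig_poly.add)
next
  case (cmult p c)
  then show ?case using trig_poly.cmult[OF cmult.IH, of c] by (simp add: mult_ac)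
qed

lemma trig_poly_mult: "trig_poly p \<Longrightarrow> trig_poly p' \<Longrightarrow> trig_poly (\<lambda>z. p z * p' z)"
proof (induction rule: trig_poly.induct)
  case (char m k)
  then show ?case by (rule trig_poly_mult_char)
next
  case (add p q)
  then show ?case by (simp add: distrib_right trig_poly.add)
next
  case (cmult p c)
  then show ?case using trig_poly.cmult[OF cmult.IH, of c] by (simp add: mult_ac)
qed

lemma trig_poly_const: "trig_poly (\<lambda>_. c)"
  using trig_poly.cmult[OF trig_poly.char[of 0 0], of c] by (simp add: case_prod_beta')

text \<open>A real linear form on C x C is a combination of the four real coordinates, and on the
  torus the real and imaginary parts of \<open>chr x\<close> are combinations of
  \<open>chr x\<close> and \<open>chr (- x)\<close>. Real polynomials thus stay within trigonometric
  polynomials, which is what permits the real Stone-Weierstrass theorem.\<close>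

lemma trig_poly_of_real_polynomial_function:
  fixes r :: "complex \<times> complex \<Rightarrow> real"
  shows "real_polynomial_function r \<Longrightarrow> trig_poly (\<lambda>(x, y). of_real (r (chr x, chr y)))"
proof (induction rule: real_polynomial_function.induct)
  case (linear L)
  interpret L: bounded_linear L by fact
  have L: "L (z, w) = Re z * L (1, 0) + Im z * L (\<i>, 0) + (Re w * L (0, 1) + Im w * L (0, \<i>))" for z w
  proof -
    have "(z, w) = Re z *\<^sub>R (1, 0) + Im z *\<^sub>R (\<i>, 0) + (Re w *\<^sub>R (0, 1) + Im w *\<^sub>R (0, \<i>))"
      by (simp add: complex_eq_iff zero_prod_def)
    then show ?thesis by (simp only: L.add L.scaleR real_scaleR_def)
  qed
  have re: "complex_of_real (Re (chr x)) = (1/2) * (chr x + chr (- x))" for x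
    by (simp add: complex_eq_iff flip: cnj_chr)
  have im: "complex_of_real (Im (chr x)) = (- \<i>/2) * (chr x + (-1) * chr (- x))" for x
    by (simp add: complex_eq_iff flip: cnj_chr)
  have x: "trig_poly (\<lambda>z. chr (fst z))" "trig_poly (\<lambda>z. chr (- fst z))"
      "trig_poly (\<lambda>z. chr (snd z))" "trig_poly (\<lambda>z. chr (- snd z))"
    using trig_poly.char[of 1 0] trig_poly.char[of "-1" 0] trig_poly.char[of 0 1] trig_poly.char[of 0 "-1"]
    by (simp_all add: case_prod_beta')
  have eq: "(\<lambda>(x, y). complex_of_real (L (chr x, chr y))) = (\<lambda>z.
       of_real (L (1, 0)) * ((1/2) * (chr (fst z) + chr (- fst z)))
     + of_real (L (\<i>, 0)) * ((- \<i>/2) * (chr (fst z) + (-1) * chr (- fst z)))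
     + (of_real (L (0, 1)) * ((1/2) * (chr (snd z) + chr (- snd z)))
     + of_real (L (0, \<i>)) * ((- \<i>/2) * (chr (snd z) + (-1) * chr (- snd z)))))"
    unfolding re[symmetric] im[symmetric] case_prod_beta' L[of "chr _"] of_real_add of_real_mult
    by (simp only: mult.commute)
  show ?case unfolding eq by (intro trig_poly.add trig_poly.cmult x)
next
  case (const c)
  then show ?case using trig_poly_const[of "of_real c"] by (simp add: case_prod_beta')
next
  case (add f g)
  from trig_poly.add[OF add.IH] show ?case by (simp add: case_prod_beta')
next
  case (mult f g)
  from trig_poly_mult[OF mult.IH] show ?case by (simp add: case_prod_beta')
qed

lemma measurable_trig_poly: "trig_poly p \<Longrightarrow> p \<in> borel_measurable borel"
proof (induction rule: trig_poly.induct)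
  case (char m k)
  have "(\<lambda>(x, y). chr (real_of_int m * x) * chr (real_of_int k * y)) \<in> borel_measurable (borel \<Otimes>\<^sub>M borel)"
    by measurable
  then show ?case by (simp add: borel_prod)
qed auto

text \<open>The map \<open>\<phi>\<close> sends \<open>[0,1)^2\<close> bijectively onto the torus,
  with Borel inverse \<open>\<psi>\<close>. Pushing \<open>N\<close> forward turns the claim into
  polynomial approximation of \<open>q\<close> composed with \<open>\<psi>\<close> on a compact set;
  \<open>\<psi>\<close> may be discontinuous because only measurability is required there.\<close>

lemma trig_poly_dense:
  fixes q :: "real \<times> real \<Rightarrow> complex" and \<epsilon> :: ennreal
  assumes N: "finite_measure N" and sets[measurable_cong]: "sets N = sets borel"
    and sq: "AE z in N. fst z \<in> {0..<1} \<and> snd z \<in> {0..<1}"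
    and q[measurable]: "q \<in> borel_measurable borel" and fin: "nsq N q < \<infinity>" and eps: "\<epsilon> > 0"
  shows "\<exists>p. trig_poly p \<and> nsq N (\<lambda>z. q z - p z) < \<epsilon>"
proof -
  interpret finite_measure N by fact
  define \<phi> :: "real \<times> real \<Rightarrow> complex \<times> complex" where "\<phi> = (\<lambda>z. (chr (fst z), chr (snd z)))"
  define \<psi> :: "complex \<times> complex \<Rightarrow> real \<times> real"
    where "\<psi> = (\<lambda>z. (Arg2pi (fst z) / (2 * pi), Arg2pi (snd z) / (2 * pi)))"
  have \<phi>[measurable]: "\<phi> \<in> borel \<rightarrow>\<^sub>M borel"
    unfolding \<phi>_def borel_prod[symmetric] by measurable
  have \<psi>[measurable]: "\<psi> \<in> borel \<rightarrow>\<^sub>M borel"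
    unfolding \<psi>_def borel_prod[symmetric] by measurable
  have \<phi>N[measurable]: "\<phi> \<in> N \<rightarrow>\<^sub>M borel" by measurable
  have inv: "\<psi> (\<phi> z) = z" if "fst z \<in> {0..<1}" "snd z \<in> {0..<1}" for z
    using that by (auto simp: \<phi>_def \<psi>_def Arg2pi_chr prod_eq_iff)
  \<comment> \<open>Membership is tested on the square, so that each approximant on the torus pulls
    back to a trigonometric polynomial at once.\<close>
  define V where "V = {r \<in> borel_measurable borel. trig_poly (\<lambda>z. r (\<phi> z))}"
  define \<nu> where "\<nu> = distr N borel \<phi>"
  have nsq: "nsq \<nu> h = nsq N (\<lambda>z. h (\<phi> z))" if "h \<in> borel_measurable borel" for h
    using that unfolding nsq_def \<nu>_def by (subst nn_integral_distr) auto
  have app: "L2_approximation \<nu> V"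
  proof (intro L2_approximation.intro L2_approximation_axioms.intro)
    show "finite_measure \<nu>" unfolding \<nu>_def by (rule finite_measure_distr[OF \<phi>N])
  qed (auto simp: V_def \<nu>_def intro: trig_poly.add trig_poly.cmult)
  interpret \<nu>: L2_approximation \<nu> V by fact
  have "\<nu>.approximable (\<lambda>w. q (\<psi> w))"
  proof (rule approximable_of_polynomials[OF app])
    show "sets \<nu> = sets borel" by (simp add: \<nu>_def)
    show "compact (sphere (0::complex) 1 \<times> sphere (0::complex) 1)"
      by (intro compact_Times) auto
    show "AE w in \<nu>. w \<in> sphere 0 1 \<times> sphere 0 1"
      unfolding \<nu>_def by (subst AE_distr_iff[OF \<phi>N]) (auto simp: \<phi>_def intro!: borel_closed[unfolded Collect_mem_eq] closed_Times)
    show "(\<lambda>x. complex_of_real (p x)) \<in> V" if "real_polynomial_function p" for p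
    proof -
      have [measurable]: "p \<in> borel_measurable borel"
        using that by (intro borel_measurable_continuous_onI continuous_on_polymonial_function)
          (simp add: real_polynomial_function_eq)
      show ?thesis
        unfolding V_def \<phi>_def using trig_poly_of_real_polynomial_function[OF that]
        by (simp add: case_prod_beta')
    qed
    show "nsq \<nu> (\<lambda>w. q (\<psi> w)) < \<infinity>"
    proof -
      have "nsq \<nu> (\<lambda>w. q (\<psi> w)) = nsq N (\<lambda>z. q (\<psi> (\<phi> z)))" by (subst nsq) auto
      also have "\<dots> = nsq N q"
        unfolding nsq_def using sq by (intro nn_integral_cong_AE) (auto simp: inv)
      finally show ?thesis using fin by simp
    qed
  qed measurable
  then obtain r where r: "r \<in> V" "nsq \<nu> (\<lambda>w. q (\<psi> w) - r w) < \<epsilon>"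
    using eps unfolding \<nu>.approximable_def by blast
  have [measurable]: "r \<in> borel_measurable borel" using r by (simp add: V_def)
  have "nsq \<nu> (\<lambda>w. q (\<psi> w) - r w) = nsq N (\<lambda>z. q (\<psi> (\<phi> z)) - r (\<phi> z))" by (subst nsq) auto
  also have "\<dots> = nsq N (\<lambda>z. q z - r (\<phi> z))"
    unfolding nsq_def using sq by (intro nn_integral_cong_AE) (auto simp: inv)
  finally show ?thesis using r by (auto simp: V_def)
qed

section \<open>Fourier coefficients on the unit interval\<close>

text \<open>Lebesgue measure on \<open>[0,1]\<close> kept as a Borel measure on all of R, so that
  measurability always refers to \<open>borel\<close> and arguments such as \<open>y + n\<close>
  need no domain conditions.\<close>

definition I01 :: "real measure" where
  "I01 = density lborel (indicator {0..1})"

lemma sets_I01 [simp, measurable_cong]: "sets I01 = sets borel"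
  by (simp add: I01_def)

lemma space_I01 [simp]: "space I01 = UNIV"
  by (simp add: I01_def)

lemma emeasure_I01_UNIV: "emeasure I01 UNIV = 1"
  by (simp add: I01_def emeasure_density)

interpretation I01: finite_measure I01
  by standard (simp add: emeasure_I01_UNIV)

lemma AE_I01: "(AE x in I01. P x) \<longleftrightarrow> (AE x in lborel. x \<in> {0..1} \<longrightarrow> P x)"
proof -
  have "(AE x in I01. P x) \<longleftrightarrow> (AE x in lborel. (0::ennreal) < indicator {0..1} x \<longrightarrow> P x)"
    unfolding I01_def by (rule AE_density) simp
  also have "\<dots> \<longleftrightarrow> (AE x in lborel. x \<in> {0..1} \<longrightarrow> P x)"
    by (intro arg_cong[where f="\<lambda>P. AE x in lborel. P x"] ext) (auto simp: indicator_def)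
  finally show ?thesis .
qed

lemma nn_integral_I01:
  assumes [measurable]: "f \<in> borel_measurable borel"
  shows "(\<integral>\<^sup>+x. f x \<partial>I01) = (\<integral>\<^sup>+x. f x * indicator {0..1} x \<partial>lborel)"
  unfolding I01_def by (subst nn_integral_density) (auto simp: mult.commute)

lemma integral_I01:
  fixes f :: "real \<Rightarrow> complex"
  assumes [measurable]: "f \<in> borel_measurable borel"
  shows "(LINT x|I01. f x) = (LINT x|lborel. indicator {0..1} x *\<^sub>R f x)"
proof -
  have eq: "I01 = density lborel (\<lambda>x. ennreal (indicator {0..1} x))"
    by (simp add: I01_def ennreal_indicator)
  show ?thesis unfolding eq by (rule integral_density) auto
qed

lemma integral_chr_I01: "(LINT x|I01. chr (of_int n * x)) = (if n = 0 then 1 else 0)"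
proof (cases "n = 0")
  case True
  have "measure I01 UNIV = 1" by (simp add: measure_def emeasure_I01_UNIV)
  with True show ?thesis by simp
next
  case False
  \<comment> \<open>An antiderivative of the integrand; its values at 0 and 1 agree because
    \<open>chr\<close> is 1 at integers.\<close>
  define F where "F = (\<lambda>x::real. exp (2 * of_real pi * \<i> * of_real (of_int n * x)) / (2 * of_real pi * \<i> * of_int n) :: complex)"
  have "(LINT x|lborel. indicator {0..1} x *\<^sub>R chr (of_int n * x)) = F 1 - F 0"
  proof (rule integral_FTC_Icc)
    fix x :: real assume "0 \<le> x" "x \<le> 1"
    have "((\<lambda>z. exp (2 * of_real pi * \<i> * (of_int n * z)) / (2 * of_real pi * \<i> * of_int n))
       has_field_derivative exp (2 * of_real pi * \<i> * (of_int n * of_real x))) (at (of_real x :: complex))"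
      using False by (auto intro!: derivative_eq_intros simp: field_simps)
    from has_vector_derivative_real_field[OF this]
    show "(F has_vector_derivative chr (of_int n * x)) (at x within {0..1})"
      by (simp add: F_def chr_def o_def)
  qed (auto intro!: continuous_on_compose2[OF continuous_on_chr] continuous_intros)
  also have "F 1 - F 0 = (chr (of_int n * 1) - chr (of_int n * 0)) / (2 * of_real pi * \<i> * of_int n)"
    by (simp add: F_def chr_def diff_divide_distrib)
  also have "\<dots> = 0" by simp
  finally show ?thesis using False by (simp add: integral_I01)
qed

text \<open>The counterpart of \<open>fourier_coeff\<close> over the Borel measure
  \<open>I01\<close>; \<open>fourier_coeff_eq_fc\<close> connects the two.\<close>

definition fc :: "(real \<Rightarrow> complex) \<Rightarrow> int \<Rightarrow> complex" where
  "fc u n = (LINT x|I01. u x * chr (- (of_int n * x)))"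

lemma nsq_finite_integrable_power2:
  assumes [measurable]: "u \<in> borel_measurable M" and "nsq M u < \<infinity>"
  shows "integrable M (\<lambda>x. (cmod (u x))\<^sup>2)"
  using assms(2) by (intro integrableI_bounded) (auto simp: nsq_def)

text \<open>The elementary bound \<open>c <= 1 + c^2\<close> replaces the Cauchy-Schwarz
  inequality.\<close>

lemma (in finite_measure) nsq_finite_integrable:
  assumes [measurable]: "u \<in> borel_measurable M" and fin: "nsq M u < \<infinity>"
  shows "integrable M u"
proof (rule Bochner_Integration.integrable_bound)
  show "integrable M (\<lambda>x. 1 + (cmod (u x))\<^sup>2)"
    using nsq_finite_integrable_power2[OF assms] by simp
  have "c \<le> 1 + c\<^sup>2" for c :: real
    using zero_le_power2[of "c - 1/2"] by (simp add: power2_eq_square algebra_simps)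
  then show "AE x in M. norm (u x) \<le> norm (1 + (cmod (u x))\<^sup>2)"
    by (auto intro!: AE_I2 simp: abs_of_nonneg add_nonneg_nonneg)
qed measurable

lemma nsq_eq_integral:
  assumes [measurable]: "u \<in> borel_measurable M" and "nsq M u < \<infinity>"
  shows "nsq M u = ennreal (LINT x|M. (cmod (u x))\<^sup>2)"
  unfolding nsq_def using nsq_finite_integrable_power2[OF assms] by (rule nn_integral_eq_integral) auto

lemma integrable_mult_chr:
  assumes "integrable I01 u" shows "integrable I01 (\<lambda>x. u x * chr (a * x))"
proof (rule Bochner_Integration.integrable_bound[OF assms])
  have [measurable]: "u \<in> borel_measurable borel" using borel_measurable_integrable[OF assms] by simp
  show "(\<lambda>x. u x * chr (a * x)) \<in> borel_measurable I01" by measurable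
qed (simp add: norm_mult)

lemma integrable_fc:
  assumes "integrable I01 u" shows "integrable I01 (\<lambda>x. u x * chr (- (of_int n * x)))"
  using integrable_mult_chr[OF assms, of "- of_int n"] by simp

lemma fc_add: "integrable I01 u \<Longrightarrow> integrable I01 v \<Longrightarrow> fc (\<lambda>x. u x + v x) n = fc u n + fc v n"
  unfolding fc_def by (simp add: distrib_right integrable_fc)

lemma fc_diff: "integrable I01 u \<Longrightarrow> integrable I01 v \<Longrightarrow> fc (\<lambda>x. u x - v x) n = fc u n - fc v n"
  unfolding fc_def by (simp add: left_diff_distrib integrable_fc)

lemma fc_cmult: "fc (\<lambda>x. c * u x) n = c * fc u n"
  unfolding fc_def by (simp add: mult.assoc)

text \<open>Under the Zak transform this shift of the index is the translation
  \<open>transl\<close>.\<close>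

lemma fc_mult_chr: "fc (\<lambda>x. chr (of_int k * x) * u x) n = fc u (n - k)"
proof -
  have "chr (- (of_int (n - k) * x)) = chr (of_int k * x) * chr (- (of_int n * x))" for x
    unfolding chr_add[symmetric] by (simp add: algebra_simps)
  then show ?thesis unfolding fc_def by (simp add: mult_ac)
qed

lemma fc_chr: "fc (\<lambda>x. chr (of_int k * x)) n = (if n = k then 1 else 0)"
proof -
  have "fc (\<lambda>x. chr (of_int k * x)) n = (LINT x|I01. chr (of_int (k - n) * x))"
    unfolding fc_def by (intro Bochner_Integration.integral_cong) (auto simp: algebra_simps simp flip: chr_add)
  also have "\<dots> = (if n = k then 1 else 0)" by (simp only: integral_chr_I01) simp
  finally show ?thesis .
qed

lemma integrable_chr: "integrable I01 (\<lambda>x. chr (a * x))"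
  using integrable_mult_chr[of "\<lambda>_. 1" a] by simp

lemma integrable_trig_sum: "finite I \<Longrightarrow> integrable I01 (\<lambda>x. \<Sum>n\<in>I. c n * chr (of_int n * x))"
  by (intro Bochner_Integration.integrable_sum integrable_mult_right integrable_chr)

lemma fc_trig_sum: "finite I \<Longrightarrow> fc (\<lambda>x. \<Sum>n\<in>I. c n * chr (of_int n * x)) n = (if n \<in> I then c n else 0)"
proof (induction rule: finite_induct)
  case empty then show ?case by (simp add: fc_def)
next
  case (insert k I)
  then show ?case
    by (simp add: fc_add integrable_trig_sum integrable_chr fc_cmult fc_chr)
qed

text \<open>Completing the square, one frequency at a time; integrability is carried along because
  the next step integrates the previous residual. The choice \<open>c = fc u\<close> gives Bessel,
  general \<open>c\<close> the hard half of Parseval, and \<open>u = 0\<close> the norm of a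
  trigonometric sum.\<close>

lemma integral_trig_residual:
  assumes [measurable]: "u \<in> borel_measurable borel" and fin: "nsq I01 u < \<infinity>" and "finite I"
  shows "integrable I01 (\<lambda>x. (cmod (u x - (\<Sum>n\<in>I. c n * chr (of_int n * x))))\<^sup>2) \<and>
    (LINT x|I01. (cmod (u x - (\<Sum>n\<in>I. c n * chr (of_int n * x))))\<^sup>2) =
    (LINT x|I01. (cmod (u x))\<^sup>2) - (\<Sum>n\<in>I. (cmod (fc u n))\<^sup>2) + (\<Sum>n\<in>I. (cmod (c n - fc u n))\<^sup>2)"
  using \<open>finite I\<close>
proof (induction rule: finite_induct)
  case empty
  then show ?case using nsq_finite_integrable_power2[of u I01] fin by simp
next
  case (insert m I)
  define R where "R = (\<lambda>x. u x - (\<Sum>n\<in>I. c n * chr (of_int n * x)))"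
  have u: "integrable I01 u" by (rule I01.nsq_finite_integrable) (use fin in auto)
  have R: "integrable I01 R" unfolding R_def using u integrable_trig_sum[OF insert(1)] by simp
  have R2: "integrable I01 (\<lambda>x. (cmod (R x))\<^sup>2)" using insert unfolding R_def by simp
  \<comment> \<open>The subtracted sum has no frequency \<open>m\<close>, so the residual keeps the
    \<open>m\<close>-th coefficient of \<open>u\<close>.\<close>
  have fcR: "fc R m = fc u m"
    unfolding R_def using u integrable_trig_sum[OF insert(1)] insert(1,2) by (simp add: fc_diff fc_trig_sum)
  define P where "P = (\<lambda>x. cnj (c m) * (R x * chr (- (of_int m * x))))"
  have eq: "(cmod (u x - (\<Sum>n\<in>insert m I. c n * chr (of_int n * x))))\<^sup>2 =
      (cmod (R x))\<^sup>2 - 2 * Re (P x) + (cmod (c m))\<^sup>2" for x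
  proof -
    have "u x - (\<Sum>n\<in>insert m I. c n * chr (of_int n * x)) = R x - c m * chr (of_int m * x)"
      using insert by (simp add: R_def)
    also have "(cmod \<dots>)\<^sup>2 = (cmod (R x))\<^sup>2 - 2 * Re (R x * cnj (c m * chr (of_int m * x))) + (cmod (c m * chr (of_int m * x)))\<^sup>2"
      by (simp only: cmod_power2) (simp add: power2_eq_square algebra_simps)
    finally show ?thesis by (simp add: P_def norm_mult cnj_chr mult_ac)
  qed
  have int: "integrable I01 P"
    unfolding P_def by (intro integrable_mult_right integrable_fc R)
  have "(LINT x|I01. (cmod (u x - (\<Sum>n\<in>insert m I. c n * chr (of_int n * x))))\<^sup>2) =
      (LINT x|I01. (cmod (R x))\<^sup>2) - 2 * (LINT x|I01. Re (P x)) + (cmod (c m))\<^sup>2"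
    unfolding eq using R2 integrable_Re[OF int] by (simp add: measure_def emeasure_I01_UNIV)
  also have "(LINT x|I01. Re (P x)) = Re (cnj (c m) * fc R m)"
    using integral_Re[OF int] by (simp only: fc_def P_def integral_mult_right_zero)
  also have "(LINT x|I01. (cmod (R x))\<^sup>2) - 2 * Re (cnj (c m) * fc R m) + (cmod (c m))\<^sup>2 =
     (LINT x|I01. (cmod (R x))\<^sup>2) - (cmod (fc u m))\<^sup>2 + (cmod (c m - fc u m))\<^sup>2"
    unfolding fcR by (simp only: cmod_power2) (simp add: power2_eq_square algebra_simps)
  finally have "(LINT x|I01. (cmod (u x - (\<Sum>n\<in>insert m I. c n * chr (of_int n * x))))\<^sup>2) =
     (LINT x|I01. (cmod (R x))\<^sup>2) - (cmod (fc u m))\<^sup>2 + (cmod (c m - fc u m))\<^sup>2" .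
  moreover have "integrable I01 (\<lambda>x. (cmod (u x - (\<Sum>n\<in>insert m I. c n * chr (of_int n * x))))\<^sup>2)"
    unfolding eq using R2 integrable_Re[OF int] by simp
  ultimately show ?case using insert(1-3) by (simp add: R_def)
qed

lemma Bessel:
  assumes "u \<in> borel_measurable borel" "nsq I01 u < \<infinity>" "finite I"
  shows "(\<Sum>n\<in>I. (cmod (fc u n))\<^sup>2) \<le> (LINT x|I01. (cmod (u x))\<^sup>2)"
proof -
  have "0 \<le> (LINT x|I01. (cmod (u x - (\<Sum>n\<in>I. fc u n * chr (of_int n * x))))\<^sup>2)"
    by (rule Bochner_Integration.integral_nonneg) simp
  then show ?thesis
    using integral_trig_residual[OF assms, of "fc u"] by simp
qed

lemma trig_poly_slice:
  "trig_poly p \<Longrightarrow> (\<lambda>x. p (x, 0)) \<in> lin_span (\<lambda>n x. chr (of_int n * x))"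
proof (induction rule: trig_poly.induct)
  case (char m k)
  show ?case by (rule lin_spanI[of "{m}" _ "\<lambda>_. 1"]) auto
qed (auto intro: lin_span_add lin_span_cmult)

text \<open>The one-dimensional case comes from the two-dimensional one by placing
  \<open>I01\<close> on the edge \<open>y = 0\<close> of the square, where trigonometric polynomials
  in two variables reduce to sums in \<open>x\<close>.\<close>

lemma trig_sum_dense:
  fixes \<epsilon> :: ennreal
  assumes [measurable]: "u \<in> borel_measurable borel" and fin: "nsq I01 u < \<infinity>" and "\<epsilon> > 0"
  shows "\<exists>I c. finite I \<and> nsq I01 (\<lambda>x. u x - (\<Sum>n\<in>I. c n * chr (of_int n * x))) < \<epsilon>"
proof -
  define N where "N = distr I01 borel (\<lambda>x. (x, 0::real))"
  have m[measurable]: "(\<lambda>x. (x, 0::real)) \<in> I01 \<rightarrow>\<^sub>M borel"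
    unfolding measurable_cong_sets[OF sets_I01 refl]
    by (intro borel_measurable_continuous_onI continuous_intros)
  have [measurable]: "(\<lambda>z::real \<times> real. u (fst z)) \<in> borel_measurable borel" unfolding borel_prod[symmetric] by measurable
  have nsq: "nsq N h = nsq I01 (\<lambda>x. h (x, 0))" if "h \<in> borel_measurable borel" for h
    using that unfolding nsq_def N_def by (subst nn_integral_distr) auto
  have "\<exists>p. trig_poly p \<and> nsq N (\<lambda>z. u (fst z) - p z) < \<epsilon>"
  proof (rule trig_poly_dense)
    show "finite_measure N" unfolding N_def by (rule I01.finite_measure_distr[OF m])
    show "sets N = sets borel" by (simp add: N_def)
    have "AE x in I01. x < 1"
      unfolding AE_I01 using AE_lborel_singleton[of 1] by eventually_elim auto
    moreover have "AE x in I01. 0 \<le> x" unfolding AE_I01 by auto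
    moreover have "Measurable.pred (borel :: (real \<times> real) measure) (\<lambda>z. fst z \<in> {0..<1} \<and> snd z \<in> {0..<1})"
      unfolding borel_prod[symmetric] by measurable
    ultimately show "AE z in N. fst z \<in> {0..<1} \<and> snd z \<in> {0..<1}"
      unfolding N_def by (subst AE_distr_iff[OF m]) (auto simp: pred_def)
    show "nsq N (\<lambda>z. u (fst z)) < \<infinity>" using fin by (simp add: nsq)
  qed (use \<open>\<epsilon> > 0\<close> in auto)
  then obtain p where p: "trig_poly p" "nsq N (\<lambda>z. u (fst z) - p z) < \<epsilon>" by blast
  have [measurable]: "p \<in> borel_measurable borel" by (rule measurable_trig_poly) fact
  have "nsq I01 (\<lambda>x. u x - p (x, 0)) < \<epsilon>" using p(2) by (simp add: nsq)
  then have "\<exists>s\<in>lin_span (\<lambda>n x. chr (of_int n * x)). nsq I01 (\<lambda>x. u x - s x) < \<epsilon>"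
    using trig_poly_slice[OF p(1)] by (rule bexI)
  then show ?thesis by (simp only: bex_lin_span_iff)
qed

text \<open>\<open>int_decode\<close> enumerates Z. One inequality is Bessel. For the other, a
  trigonometric sum within squared distance \<open>e\<close> of \<open>u\<close> shows, by
  \<open>integral_trig_residual\<close>, that finitely many coefficients account for the norm up to
  \<open>e\<close>.\<close>

lemma Parseval:
  assumes [measurable]: "u \<in> borel_measurable borel" and fin: "nsq I01 u < \<infinity>"
  shows "(\<Sum>k. ennreal ((cmod (fc u (int_decode k)))\<^sup>2)) = nsq I01 u"
proof (rule antisym)
  have nsq_u: "nsq I01 u = ennreal (LINT x|I01. (cmod (u x))\<^sup>2)"
    by (rule nsq_eq_integral) (use fin in auto)
  show "(\<Sum>k. ennreal ((cmod (fc u (int_decode k)))\<^sup>2)) \<le> nsq I01 u"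
  proof (rule suminf_le_const)
    fix N
    have "(\<Sum>k<N. (cmod (fc u (int_decode k)))\<^sup>2) = (\<Sum>n\<in>int_decode ` {..<N}. (cmod (fc u n))\<^sup>2)"
      by (subst sum.reindex) (auto intro: inj_on_subset[OF inj_int_decode])
    also have "\<dots> \<le> (LINT x|I01. (cmod (u x))\<^sup>2)" by (intro Bessel) (use fin in auto)
    finally show "(\<Sum>k<N. ennreal ((cmod (fc u (int_decode k)))\<^sup>2)) \<le> nsq I01 u"
      unfolding nsq_u by (simp add: ennreal_leI)
  qed simp
  show "nsq I01 u \<le> (\<Sum>k. ennreal ((cmod (fc u (int_decode k)))\<^sup>2))"
  proof (rule ennreal_le_epsilon)
    fix e :: real assume "e > 0"
    then obtain I c where I: "finite I" and
      lt: "nsq I01 (\<lambda>x. u x - (\<Sum>n\<in>I. c n * chr (of_int n * x))) < ennreal e"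
      using trig_sum_dense[OF _ fin, of "ennreal e"] by auto
    note res = integral_trig_residual[OF _ fin I, of c, simplified]
    have "ennreal (LINT x|I01. (cmod (u x - (\<Sum>n\<in>I. c n * chr (of_int n * x))))\<^sup>2) < ennreal e"
      using lt by (subst (asm) nsq_eq_integral) (use lt in \<open>auto simp: less_top[symmetric] intro: order.strict_trans\<close>)
    then have "(LINT x|I01. (cmod (u x - (\<Sum>n\<in>I. c n * chr (of_int n * x))))\<^sup>2) \<le> e"
      using \<open>e > 0\<close> by (simp add: ennreal_less_iff)
    moreover have "0 \<le> (\<Sum>n\<in>I. (cmod (c n - fc u n))\<^sup>2)" by (intro sum_nonneg) auto
    ultimately have le: "(LINT x|I01. (cmod (u x))\<^sup>2) \<le> (\<Sum>n\<in>I. (cmod (fc u n))\<^sup>2) + e"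
      using res by simp
    have "(\<Sum>n\<in>I. (cmod (fc u n))\<^sup>2) = (\<Sum>k\<in>int_encode ` I. (cmod (fc u (int_decode k)))\<^sup>2)"
      by (subst sum.reindex) (auto intro: inj_on_subset[OF inj_int_encode])
    then have "ennreal (\<Sum>n\<in>I. (cmod (fc u n))\<^sup>2) = (\<Sum>k\<in>int_encode ` I. ennreal ((cmod (fc u (int_decode k)))\<^sup>2))"
      by simp
    also have "\<dots> \<le> (\<Sum>k. ennreal ((cmod (fc u (int_decode k)))\<^sup>2))"
      by (intro sum_le_suminf) (use I in auto)
    finally have "ennreal (\<Sum>n\<in>I. (cmod (fc u n))\<^sup>2) + ennreal e \<le> (\<Sum>k. ennreal ((cmod (fc u (int_decode k)))\<^sup>2)) + ennreal e"
      by (rule add_right_mono)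
    moreover have "nsq I01 u \<le> ennreal (\<Sum>n\<in>I. (cmod (fc u n))\<^sup>2) + ennreal e"
      unfolding nsq_u using le \<open>e > 0\<close> by (subst ennreal_plus[symmetric]) (auto intro!: ennreal_leI sum_nonneg)
    ultimately show "nsq I01 u \<le> (\<Sum>k. ennreal ((cmod (fc u (int_decode k)))\<^sup>2)) + ennreal e"
      by (rule order_trans[rotated])
  qed
qed

section \<open>The Zak transform\<close>

text \<open>The line is cut into the intervals \<open>[n, n+1)\<close>, and each is translated back
  to the unit interval.\<close>

lemma nn_integral_lborel_periodize:
  fixes w :: "real \<Rightarrow> ennreal"
  assumes [measurable]: "w \<in> borel_measurable borel"
  shows "(\<integral>\<^sup>+x. w x \<partial>lborel) = (\<integral>\<^sup>+y. (\<Sum>k. w (y + of_int (int_decode k))) \<partial>I01)"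
proof -
  define J where "J k = {of_int (int_decode k) ..< of_int (int_decode k) + 1 :: real}" for k
  have [measurable]: "J k \<in> sets borel" for k by (simp add: J_def)
  have J: "x \<in> J k \<longleftrightarrow> int_decode k = \<lfloor>x\<rfloor>" for x k
    unfolding J_def by (auto simp: floor_eq_iff eq_commute)
  have disj: "disjoint_family J"
    unfolding disjoint_family_on_def by (auto simp: J) (metis int_decode_inverse)
  have cover: "(\<Union>k. J k) = UNIV"
    using surj_int_decode by (auto simp: J surj_def) (metis)
  have "(\<integral>\<^sup>+x. w x \<partial>lborel) = (\<integral>\<^sup>+x. (\<Sum>k. w x * indicator (J k) x) \<partial>lborel)"
    by (simp add: ennreal_suminf_cmult suminf_indicator[OF disj] cover)
  also have "\<dots> = (\<Sum>k. \<integral>\<^sup>+x. w x * indicator (J k) x \<partial>lborel)"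
    by (rule nn_integral_suminf) measurable
  also have "\<dots> = (\<Sum>k. \<integral>\<^sup>+y. w (y + of_int (int_decode k)) \<partial>I01)"
  proof (intro suminf_cong)
    fix k
    have "(\<integral>\<^sup>+x. w x * indicator (J k) x \<partial>lborel) =
        (\<integral>\<^sup>+y. w (of_int (int_decode k) + 1 * y) * indicator (J k) (of_int (int_decode k) + 1 * y) \<partial>lborel)"
      by (subst nn_integral_real_affine[where c=1 and t="of_int (int_decode k)"]) auto
    also have "\<dots> = (\<integral>\<^sup>+y. w (y + of_int (int_decode k)) * indicator {0..1} y \<partial>lborel)"
    proof (rule nn_integral_cong_AE)
      show "AE y in lborel. w (of_int (int_decode k) + 1 * y) * indicator (J k) (of_int (int_decode k) + 1 * y) =
          w (y + of_int (int_decode k)) * indicator {0..1} y"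
        \<comment> \<open>The translate of \<open>J k\<close> is \<open>[0,1)\<close>, which differs
          from \<open>{0..1}\<close> only in the null point 1.\<close>
        using AE_lborel_singleton[of "1::real"]
        by eventually_elim (auto simp: J_def indicator_def add.commute)
    qed
    also have "\<dots> = (\<integral>\<^sup>+y. w (y + of_int (int_decode k)) \<partial>I01)"
      by (subst nn_integral_I01) auto
    finally show "(\<integral>\<^sup>+x. w x * indicator (J k) x \<partial>lborel) = (\<integral>\<^sup>+y. w (y + of_int (int_decode k)) \<partial>I01)" .
  qed
  also have "\<dots> = (\<integral>\<^sup>+y. (\<Sum>k. w (y + of_int (int_decode k))) \<partial>I01)"
    by (rule nn_integral_suminf[symmetric]) measurable
  finally show ?thesis .
qed

text \<open>Translates of a null set are null, and there are only countably many integers.\<close>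

lemma AE_lborel_translates:
  assumes "AE x in lborel. P (x :: real)"
  shows "AE y in lborel. \<forall>n::int. P (y + of_int n)"
proof -
  have "AE y in lborel. P (y + of_int n)" for n :: int
  proof -
    have "AE x in distr lborel borel ((+) (of_int n)). P x"
      using assms lborel_distr_plus by metis
    then show ?thesis
      by (auto dest!: AE_distrD[rotated] simp: add.commute[of _ "of_int n"])
  qed
  then show ?thesis by (simp add: AE_all_countable)
qed

section \<open>The unit square and its slices at fixed \<open>y\<close>\<close>

abbreviation unit_square :: "(real \<times> real) measure" where
  "unit_square \<equiv> I01 \<Otimes>\<^sub>M I01"

interpretation I01_pair: pair_sigma_finite I01 I01 ..

lemma sets_unit_square [simp]: "sets unit_square = sets borel"
proof -
  have "sets unit_square = sets (borel \<Otimes>\<^sub>M (borel :: real measure))" by (rule sets_pair_measure_cong) (rule sets_I01)+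
  also have "\<dots> = sets borel" unfolding borel_prod ..
  finally show ?thesis .
qed

lemma measurable_unit_square [simp]: "measurable unit_square M = measurable borel M"
  by (rule measurable_cong_sets[OF sets_unit_square refl])

lemma space_unit_square [simp]: "space unit_square = UNIV"
  by (simp add: space_pair_measure)

text \<open>\<open>AE_pair\<close> puts the first coordinate outside; the coordinates are swapped
  because slices of a Zak transform fix the second one.\<close>

lemma AE_unit_square_slices:
  assumes "AE z in unit_square. P z"
  shows "AE y in I01. AE x in I01. P (x, y)"
proof -
  have "AE z in distr unit_square unit_square (\<lambda>(x, y). (y, x)). P z"
    using assms I01_pair.distr_pair_swap by metis
  then have "AE z in unit_square. P (case z of (x, y) \<Rightarrow> (y, x))"
    by (rule AE_distrD[OF measurable_pair_swap'])
  from I01_pair.AE_pair[OF this] show ?thesis by simp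
qed

lemma measurable_slice:
  assumes "u \<in> borel_measurable (borel :: (real \<times> real) measure)"
  shows "(\<lambda>x. u (x, y)) \<in> borel_measurable borel"
proof -
  have "(\<lambda>x. (x, y)) \<in> borel \<rightarrow>\<^sub>M (borel :: (real \<times> real) measure)"
    by (intro borel_measurable_continuous_onI continuous_intros)
  from measurable_compose[OF this assms] show ?thesis .
qed

lemma nsq_unit_square:
  assumes [measurable]: "u \<in> borel_measurable borel"
  shows "nsq unit_square u = (\<integral>\<^sup>+y. nsq I01 (\<lambda>x. u (x, y)) \<partial>I01)"
  unfolding nsq_def by (rule I01_pair.nn_integral_snd[symmetric]) simp

text \<open>\<open>u\<close> is the Zak transform of \<open>v\<close>; values of \<open>u\<close> outside the unit square are irrelevant.\<close>

definition zak :: "(real \<times> real \<Rightarrow> complex) \<Rightarrow> (real \<Rightarrow> complex) \<Rightarrow> bool" where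
  "zak u v \<longleftrightarrow> u \<in> borel_measurable borel \<and> v \<in> borel_measurable borel \<and>
     (AE y in I01. nsq I01 (\<lambda>x. u (x, y)) < \<infinity> \<and> (\<forall>n. v (y + of_int n) = fc (\<lambda>x. u (x, y)) n))"

text \<open>Parseval on almost every slice, integrated over \<open>y\<close>. Both sides may be
  infinite, so a finite norm of \<open>v\<close> yields square integrability of \<open>u\<close>
  although \<open>zak\<close> controls only slices.\<close>

lemma zak_isometry:
  assumes "zak u v"
  shows "nsq lborel v = nsq unit_square u"
proof -
  have [measurable]: "u \<in> borel_measurable borel" "v \<in> borel_measurable borel"
    and ae: "AE y in I01. nsq I01 (\<lambda>x. u (x, y)) < \<infinity> \<and> (\<forall>n. v (y + of_int n) = fc (\<lambda>x. u (x, y)) n)"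
    using assms by (auto simp: zak_def)
  have "nsq lborel v = (\<integral>\<^sup>+y. (\<Sum>k. ennreal ((cmod (v (y + of_int (int_decode k))))\<^sup>2)) \<partial>I01)"
    unfolding nsq_def by (rule nn_integral_lborel_periodize) measurable
  also have "\<dots> = (\<integral>\<^sup>+y. nsq I01 (\<lambda>x. u (x, y)) \<partial>I01)"
    using ae
  proof (intro nn_integral_cong_AE, eventually_elim)
    fix y assume y: "nsq I01 (\<lambda>x. u (x, y)) < \<infinity> \<and> (\<forall>n. v (y + of_int n) = fc (\<lambda>x. u (x, y)) n)"
    then show "(\<Sum>k. ennreal ((cmod (v (y + of_int (int_decode k))))\<^sup>2)) = nsq I01 (\<lambda>x. u (x, y))"
      by (simp add: Parseval[OF measurable_slice])
  qed
  finally show ?thesis by (simp add: nsq_unit_square)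
qed

lemma zak_zero: "zak (\<lambda>_. 0) (\<lambda>_. 0)"
  by (simp add: zak_def nsq_def fc_def)

lemma zak_cmult:
  assumes "zak u v" shows "zak (\<lambda>z. c * u z) (\<lambda>t. c * v t)"
proof -
  have [measurable]: "u \<in> borel_measurable borel" "v \<in> borel_measurable borel"
    and ae: "AE y in I01. nsq I01 (\<lambda>x. u (x, y)) < \<infinity> \<and> (\<forall>n. v (y + of_int n) = fc (\<lambda>x. u (x, y)) n)"
    using assms by (auto simp: zak_def)
  have [measurable]: "(\<lambda>x. u (x, y)) \<in> borel_measurable borel" for y by (rule measurable_slice) simp
  show ?thesis unfolding zak_def
  proof (intro conjI)
    show "AE y in I01. nsq I01 (\<lambda>x. c * u (x, y)) < \<infinity> \<and>
       (\<forall>n. c * v (y + of_int n) = fc (\<lambda>x. c * u (x, y)) n)"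
      using ae by eventually_elim (simp add: nsq_cmult ennreal_mult_less_top fc_cmult)
  qed measurable
qed

lemma zak_add:
  assumes "zak u v" "zak u' v'" shows "zak (\<lambda>z. u z + u' z) (\<lambda>t. v t + v' t)"
proof -
  have [measurable]: "u \<in> borel_measurable borel" "v \<in> borel_measurable borel"
     "u' \<in> borel_measurable borel" "v' \<in> borel_measurable borel"
    and ae: "AE y in I01. nsq I01 (\<lambda>x. u (x, y)) < \<infinity> \<and> (\<forall>n. v (y + of_int n) = fc (\<lambda>x. u (x, y)) n)"
      "AE y in I01. nsq I01 (\<lambda>x. u' (x, y)) < \<infinity> \<and> (\<forall>n. v' (y + of_int n) = fc (\<lambda>x. u' (x, y)) n)"
    using assms by (auto simp: zak_def)
  have [measurable]: "(\<lambda>x. u (x, y)) \<in> borel_measurable borel" "(\<lambda>x. u' (x, y)) \<in> borel_measurable borel" for y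
    by (rule measurable_slice, simp)+
  show ?thesis unfolding zak_def
  proof (intro conjI)
    show "AE y in I01. nsq I01 (\<lambda>x. u (x, y) + u' (x, y)) < \<infinity> \<and>
       (\<forall>n. v (y + of_int n) + v' (y + of_int n) = fc (\<lambda>x. u (x, y) + u' (x, y)) n)"
      using ae
    proof eventually_elim
      case (elim y)
      have "nsq I01 (\<lambda>x. u (x, y) + u' (x, y)) \<le> 2 * nsq I01 (\<lambda>x. u (x, y)) + 2 * nsq I01 (\<lambda>x. u' (x, y))"
        by (rule nsq_add) measurable
      also have "\<dots> < \<infinity>" using elim by (simp add: ennreal_mult_less_top)
      finally show ?case
        using elim by (simp add: fc_add I01.nsq_finite_integrable)
    qed
  qed measurable
qed

lemma zak_diff: "zak u v \<Longrightarrow> zak u' v' \<Longrightarrow> zak (\<lambda>z. u z - u' z) (\<lambda>t. v t - v' t)"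
  using zak_add[of u v "\<lambda>z. (-1) * u' z" "\<lambda>t. (-1) * v' t"] zak_cmult[of u' v' "-1"] by simp

lemma modul_eq_chr: "modul c f x = chr (c * x) * f x"
  by (simp add: modul_def chr_def)

text \<open>Translation shifts the Fourier index, hence the factor in \<open>x\<close>. Modulation
  contributes \<open>chr (m * (y + n))\<close>, which does not depend on \<open>n\<close> and so
  leaves a factor in \<open>y\<close> alone.\<close>

lemma zak_modul_transl:
  assumes "zak u v"
  shows "zak (\<lambda>z. (case z of (x, y) \<Rightarrow> chr (of_int k * x) * chr (of_int m * y)) * u z)
    (modul (of_int m) (transl (of_int k) v))"
proof -
  have [measurable]: "u \<in> borel_measurable borel" "v \<in> borel_measurable borel"
    and ae: "AE y in I01. nsq I01 (\<lambda>x. u (x, y)) < \<infinity> \<and> (\<forall>n. v (y + of_int n) = fc (\<lambda>x. u (x, y)) n)"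
    using assms by (auto simp: zak_def)
  have [measurable]: "(\<lambda>z. (case z of (x, y) \<Rightarrow> chr (of_int k * x) * chr (of_int m * y))) \<in> borel_measurable borel"
    by (intro measurable_trig_poly trig_poly.char)
  have [measurable]: "modul (of_int m) (transl (of_int k) v) \<in> borel_measurable borel"
    unfolding modul_eq_chr[abs_def] transl_def by measurable
  show ?thesis unfolding zak_def
  proof (intro conjI)
    show "AE y in I01. nsq I01 (\<lambda>x. (case (x, y) of (x, y) \<Rightarrow> chr (of_int k * x) * chr (of_int m * y)) * u (x, y)) < \<infinity> \<and>
       (\<forall>n. modul (of_int m) (transl (of_int k) v) (y + of_int n) =
          fc (\<lambda>x. (case (x, y) of (x, y) \<Rightarrow> chr (of_int k * x) * chr (of_int m * y)) * u (x, y)) n)"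
      using ae
    proof eventually_elim
      case (elim y)
      have "fc (\<lambda>x. chr (of_int k * x) * chr (of_int m * y) * u (x, y)) n =
          chr (of_int m * y) * v (y + of_int (n - k))" for n
      proof -
        have "fc (\<lambda>x. chr (of_int k * x) * chr (of_int m * y) * u (x, y)) n =
          fc (\<lambda>x. chr (of_int m * y) * (chr (of_int k * x) * u (x, y))) n" by (simp add: mult_ac)
        then show ?thesis using elim by (simp only: fc_cmult fc_mult_chr)
      qed
      moreover have "chr (of_int m * (y + of_int n)) = chr (of_int m * y)" for n
        unfolding distrib_left chr_add of_int_mult[symmetric] by (simp only: chr_of_int mult_1_right)
      ultimately show ?case
        using elim by (simp add: modul_eq_chr transl_def nsq_def norm_mult algebra_simps)
    qed
  qed measurable
qed

section \<open>Riesz-Fischer construction of Zak transforms\<close>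

lemma nsq_trig_sum:
  assumes "finite K"
  shows "nsq I01 (\<lambda>x. \<Sum>k\<in>K. b k * chr (of_int (int_decode k) * x)) = ennreal (\<Sum>k\<in>K. (cmod (b k))\<^sup>2)"
proof -
  define c where "c n = b (int_encode n)" for n
  have eq: "(\<Sum>k\<in>K. b k * chr (of_int (int_decode k) * x)) = (\<Sum>n\<in>int_decode ` K. c n * chr (of_int n * x))" for x
    by (subst sum.reindex) (auto simp: c_def intro: inj_on_subset[OF inj_int_decode])
  have eq2: "(\<Sum>k\<in>K. (cmod (b k))\<^sup>2) = (\<Sum>n\<in>int_decode ` K. (cmod (c n))\<^sup>2)"
    by (subst sum.reindex) (auto simp: c_def intro: inj_on_subset[OF inj_int_decode])
  have fc0: "fc (\<lambda>x. 0) n = 0" for n by (simp add: fc_def)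
  have "finite (int_decode ` K)" using assms by simp
  \<comment> \<open>For \<open>u = 0\<close> the residual is minus the sum and all coefficients of
    \<open>u\<close> vanish.\<close>
  from integral_trig_residual[of "\<lambda>_. 0", OF _ _ this, of c]
  have int: "integrable I01 (\<lambda>x. (cmod (\<Sum>n\<in>int_decode ` K. c n * chr (of_int n * x)))\<^sup>2)"
    and val: "(LINT x|I01. (cmod (\<Sum>n\<in>int_decode ` K. c n * chr (of_int n * x)))\<^sup>2) = (\<Sum>n\<in>int_decode ` K. (cmod (c n))\<^sup>2)"
    unfolding fc0 by (simp_all add: nsq_def)
  show ?thesis
    unfolding eq eq2 val[symmetric] nsq_def by (rule nn_integral_eq_integral[OF int]) auto
qed

text \<open>The identification half of Riesz-Fischer: an a.e. limit along a subsequence is, by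
  Fatou, also the L^2 limit of all partial sums, and Fourier coefficients are continuous in L^2 by
  Bessel.\<close>

lemma fourier_series_subsequence_limit:
  assumes summable: "summable (\<lambda>k. (cmod (b k))\<^sup>2)" and N: "\<And>j. j \<le> N j"
    and [measurable]: "u \<in> borel_measurable borel"
    and lim: "AE x in I01. (\<lambda>j. \<Sum>k<N j. b k * chr (of_int (int_decode k) * x)) \<longlonglongrightarrow> u x"
  shows "nsq I01 u < \<infinity> \<and> (\<forall>k. fc u (int_decode k) = b k)"
proof -
  define S where "S n x = (\<Sum>k<n. b k * chr (of_int (int_decode k) * x))" for n x
  have [measurable]: "S n \<in> borel_measurable borel" for n unfolding S_def by measurable
  have nsqS: "nsq I01 (S n) < \<infinity>" for n
    unfolding S_def by (subst nsq_trig_sum) auto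
  have tail: "\<exists>M. \<forall>n\<ge>M. nsq I01 (\<lambda>x. u x - S n x) \<le> ennreal e" if "e > 0" for e
  proof -
    obtain M where M: "\<And>m n. m \<ge> M \<Longrightarrow> (\<Sum>k\<in>{m..<n}. (cmod (b k))\<^sup>2) < e"
    proof -
      obtain M where "\<And>m n. m \<ge> M \<Longrightarrow> norm (\<Sum>k\<in>{m..<n}. (cmod (b k))\<^sup>2) < e"
        using summable \<open>e > 0\<close> unfolding summable_Cauchy by blast
      then show ?thesis by (intro that[of M]) (auto simp: sum_nonneg)
    qed
    have "nsq I01 (\<lambda>x. u x - S n x) \<le> ennreal e" if "n \<ge> M" for n
    proof -
      \<comment> \<open>Writing the limit as a \<open>liminf\<close> prepares Fatou; the norms of
        \<open>S (N j) - S n\<close> are blocks of the coefficient series beyond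
        \<open>n\<close>.\<close>
      have "nsq I01 (\<lambda>x. u x - S n x) = (\<integral>\<^sup>+x. liminf (\<lambda>j. ennreal ((cmod (S (N j) x - S n x))\<^sup>2)) \<partial>I01)"
        unfolding nsq_def
      proof (intro nn_integral_cong_AE)
        show "AE x in I01. ennreal ((cmod (u x - S n x))\<^sup>2) = liminf (\<lambda>j. ennreal ((cmod (S (N j) x - S n x))\<^sup>2))"
          using lim
        proof eventually_elim
          case (elim x)
          then have "(\<lambda>j. ennreal ((cmod (S (N j) x - S n x))\<^sup>2)) \<longlonglongrightarrow> ennreal ((cmod (u x - S n x))\<^sup>2)"
            unfolding S_def by (intro tendsto_ennrealI tendsto_intros)
          from lim_imp_Liminf[OF _ this] show ?case by simp
        qed
      qed
      also have "\<dots> \<le> liminf (\<lambda>j. nsq I01 (\<lambda>x. S (N j) x - S n x))"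
        unfolding nsq_def by (rule nn_integral_liminf) measurable
      also have "\<dots> \<le> liminf (\<lambda>j. ennreal e)"
      proof (rule Liminf_mono)
        show "\<forall>\<^sub>F j in sequentially. nsq I01 (\<lambda>x. S (N j) x - S n x) \<le> ennreal e"
          using eventually_ge_at_top[of n]
        proof eventually_elim
          case (elim j)
          then have "n \<le> N j" using N[of j] by simp
          then have "S (N j) x - S n x = (\<Sum>k\<in>{n..<N j}. b k * chr (of_int (int_decode k) * x))" for x
            unfolding S_def by (simp add: sum_diff_nat_ivl lessThan_atLeast0)
          then have "nsq I01 (\<lambda>x. S (N j) x - S n x) = ennreal (\<Sum>k\<in>{n..<N j}. (cmod (b k))\<^sup>2)"
            by (simp add: nsq_trig_sum)
          then show ?case using M[OF that, of "N j"] by (simp add: ennreal_leI)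
        qed
      qed
      also have "\<dots> = ennreal e" by (simp add: Liminf_const)
      finally show ?thesis .
    qed
    then show ?thesis by blast
  qed
  obtain M where "nsq I01 (\<lambda>x. u x - S M x) \<le> ennreal 1" using tail[of 1] by auto
  then have *: "nsq I01 (\<lambda>x. u x - S M x) < \<infinity>" by (rule order.strict_trans1) simp
  have "nsq I01 u = nsq I01 (\<lambda>x. (u x - S M x) + S M x)" by simp
  also have "\<dots> \<le> 2 * nsq I01 (\<lambda>x. u x - S M x) + 2 * nsq I01 (S M)" by (rule nsq_add) auto
  also have "\<dots> < \<infinity>" using * nsqS by (simp add: ennreal_mult_less_top)
  finally have fin: "nsq I01 u < \<infinity>" .
  have "fc u (int_decode k) = b k" for k
  proof -
    have "(cmod (fc u (int_decode k) - b k))\<^sup>2 \<le> e" if "e > 0" for e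
    proof -
      obtain M where M: "\<And>n. n \<ge> M \<Longrightarrow> nsq I01 (\<lambda>x. u x - S n x) \<le> ennreal e" using tail[OF \<open>e > 0\<close>] by auto
      \<comment> \<open>Larger than \<open>k\<close>, so that the partial sum contains the term of
        index \<open>k\<close>.\<close>
      define n where "n = max M (Suc k)"
      have le: "nsq I01 (\<lambda>x. u x - S n x) \<le> ennreal e" using M[of n] by (simp add: n_def)
      then have lt: "nsq I01 (\<lambda>x. u x - S n x) < \<infinity>" by (rule order.strict_trans1) simp
      have "fc (S n) (int_decode k) = b k"
      proof -
        have "S n = (\<lambda>x. \<Sum>m\<in>int_decode ` {..<n}. b (int_encode m) * chr (of_int m * x))"
          unfolding S_def by (subst sum.reindex) (auto intro: inj_on_subset[OF inj_int_decode])
        then have "fc (S n) (int_decode k) = (if int_decode k \<in> int_decode ` {..<n} then b (int_encode (int_decode k)) else 0)"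
          using fc_trig_sum[of "int_decode ` {..<n}"] by simp
        then show ?thesis by (simp add: n_def)
      qed
      then have fcd: "fc (\<lambda>x. u x - S n x) (int_decode k) = fc u (int_decode k) - b k"
        using I01.nsq_finite_integrable[of u] I01.nsq_finite_integrable[of "S n"] fin nsqS by (simp add: fc_diff)
      have "(\<Sum>m\<in>{int_decode k}. (cmod (fc (\<lambda>x. u x - S n x) m))\<^sup>2) \<le> (LINT x|I01. (cmod (u x - S n x))\<^sup>2)"
        by (rule Bessel) (use lt in auto)
      then have "(cmod (fc u (int_decode k) - b k))\<^sup>2 \<le> (LINT x|I01. (cmod (u x - S n x))\<^sup>2)" by (simp add: fcd)
      also have "\<dots> \<le> e"
        using le by (subst (asm) nsq_eq_integral) (use lt that in auto)
      finally show ?thesis .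
    qed
    then have "(cmod (fc u (int_decode k) - b k))\<^sup>2 \<le> 0" by (rule field_le_epsilon[of _ 0, simplified])
    then show ?thesis by simp
  qed
  with fin show ?thesis by simp
qed

text \<open>The partial sums are jointly measurable in \<open>x\<close> and \<open>y\<close>. A
  sequence \<open>N\<close>, independent of \<open>y\<close>, is chosen so fast that the increments
  are summable in L^1 of the square; the partial sums along \<open>N\<close> then converge a.e. on
  the square, and almost every slice falls under
  \<open>fourier_series_subsequence_limit\<close>.\<close>

lemma zak_exists:
  assumes v[measurable]: "v \<in> borel_measurable borel" and fin: "nsq lborel v < \<infinity>"
  obtains u where "zak u v"
proof -
  define b where "b y k = v (y + of_int (int_decode k))" for y k
  have [measurable]: "(\<lambda>y. b y k) \<in> borel_measurable borel" for k unfolding b_def by measurable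
  have int: "(\<integral>\<^sup>+y. (\<Sum>k. ennreal ((cmod (b y k))\<^sup>2)) \<partial>I01) < \<infinity>"
    using fin unfolding nsq_def b_def by (subst (asm) nn_integral_lborel_periodize) auto
  define a where "a k = enn2real (nsq I01 (\<lambda>y. b y k))" for k
  have suma: "(\<Sum>k. nsq I01 (\<lambda>y. b y k)) < \<infinity>"
    using int by (subst (asm) nn_integral_suminf) (auto simp: nsq_def)
  have a: "ennreal (a k) = nsq I01 (\<lambda>y. b y k)" for k
  proof -
    have "nsq I01 (\<lambda>y. b y k) \<le> (\<Sum>k. nsq I01 (\<lambda>y. b y k))"
      using sum_le_suminf[of "\<lambda>k. nsq I01 (\<lambda>y. b y k)" "{k}"] by simp
    then have "nsq I01 (\<lambda>y. b y k) < top" using suma by (auto intro: order.strict_trans1)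
    then show ?thesis unfolding a_def by (rule ennreal_enn2real)
  qed
  have a0: "0 \<le> a k" for k by (simp add: a_def)
  have "summable a"
  proof (rule summable_suminf_not_top)
    show "(\<Sum>k. ennreal (a k)) \<noteq> top" using suma by (simp add: a less_top)
  qed (rule a0)
  \<comment> \<open>The tolerance is \<open>4^-j\<close> because the L^1 estimate multiplies it by
    \<open>2^j\<close> and must leave a summable bound.\<close>
  then have "\<exists>M. \<forall>m\<ge>M. \<forall>n. sum a {m..<n} < (1/4) ^ j" for j
    unfolding summable_Cauchy by (auto simp: a0 sum_nonneg dest!: spec[of _ "(1/4) ^ j"])
  then obtain M where M: "\<And>j m n. m \<ge> M j \<Longrightarrow> sum a {m..<n} < (1/4) ^ j" by metis
  \<comment> \<open>The sum over \<open>M\<close> makes \<open>N\<close> monotone and at least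
    \<open>M j\<close>; the summand \<open>j\<close> provides \<open>j <= N j\<close>.\<close>
  define N where "N j = j + sum M {..j}" for j
  have N_ge: "j \<le> N j" "M j \<le> N j" for j
    using member_le_sum[of j "{..j}" M] by (auto simp: N_def)
  have N_mono: "N j \<le> N (Suc j)" for j by (simp add: N_def)
  define S where "S n z = (\<Sum>k<n. b (snd z) k * chr (of_int (int_decode k) * fst z))" for n z
  have S[measurable]: "S n \<in> borel_measurable borel" for n
  proof -
    have "S n \<in> borel_measurable (borel \<Otimes>\<^sub>M borel)" unfolding S_def b_def by measurable
    then show ?thesis by (simp add: borel_prod)
  qed
  define D where "D j z = S (N (Suc j)) z - S (N j) z" for j z
  have D[measurable]: "D j \<in> borel_measurable borel" for j unfolding D_def by measurable
  have nsqD: "nsq unit_square (D j) \<le> ennreal ((1/4) ^ j)" for j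
  proof -
    have Dj: "D j (x, y) = (\<Sum>k\<in>{N j..<N (Suc j)}. b y k * chr (of_int (int_decode k) * x))" for x y
      unfolding D_def S_def using N_mono[of j] by (simp add: sum_diff_nat_ivl lessThan_atLeast0)
    have "nsq unit_square (D j) = (\<integral>\<^sup>+y. ennreal (\<Sum>k\<in>{N j..<N (Suc j)}. (cmod (b y k))\<^sup>2) \<partial>I01)"
      by (simp add: nsq_unit_square Dj nsq_trig_sum)
    also have "\<dots> = (\<Sum>k\<in>{N j..<N (Suc j)}. nsq I01 (\<lambda>y. b y k))"
      unfolding nsq_def by (simp add: nn_integral_sum flip: sum_ennreal)
    also have "\<dots> = ennreal (sum a {N j..<N (Suc j)})"
      by (simp add: a0 flip: a)
    also have "\<dots> \<le> ennreal ((1/4) ^ j)"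
      using M[OF N_ge(2), of j "N (Suc j)"] by (intro ennreal_leI) simp
    finally show ?thesis .
  qed
  \<comment> \<open>On a probability space, \<open>\<bar>D\<bar> \<le> 2\<^sup>-\<^sup>j + 2\<^sup>j \<bar>D\<bar>\<^sup>2\<close> replaces the Cauchy--Schwarz inequality.\<close>
  have L1: "(\<integral>\<^sup>+z. ennreal (cmod (D j z)) \<partial>unit_square) \<le> ennreal (2 * (1/2) ^ j)" for j
  proof -
    have ineq: "t \<le> (1/2) ^ j + 2 ^ j * t\<^sup>2" for t :: real
    proof -
      \<comment> \<open>The claim multiplied by \<open>2^j\<close>, with the square completed: the
        constants 1/4 and 3/4 add up to \<open>2^j * (1/2)^j = 1\<close>.\<close>
      have "0 \<le> (2 ^ j * t - 1/2)\<^sup>2 + 3/4" by simp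
      also have "\<dots> = 2 ^ j * ((1/2) ^ j + 2 ^ j * t\<^sup>2 - t)"
        by (simp add: power2_eq_square algebra_simps power_one_over)
      finally have "0 \<le> (1/2) ^ j + 2 ^ j * t\<^sup>2 - t"
        by (rule mult_left_le_imp_le[of "2 ^ j" 0, unfolded mult_zero_right]) simp
      then show ?thesis by simp
    qed
    have "(\<integral>\<^sup>+z. ennreal (cmod (D j z)) \<partial>unit_square) \<le>
        (\<integral>\<^sup>+z. ennreal ((1/2) ^ j) + ennreal (2 ^ j) * ennreal ((cmod (D j z))\<^sup>2) \<partial>unit_square)"
      by (intro nn_integral_mono)
        (use ineq in \<open>simp flip: ennreal_plus ennreal_mult add: ennreal_leI\<close>)
    also have "\<dots> = ennreal ((1/2) ^ j) * emeasure unit_square UNIV + ennreal (2 ^ j) * nsq unit_square (D j)"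
      unfolding nsq_def by (subst nn_integral_add) (auto simp: nn_integral_cmult)
    also have "emeasure unit_square UNIV = 1"
      using I01.emeasure_pair_measure_Times[of UNIV I01 UNIV] by (simp add: emeasure_I01_UNIV)
    also have "ennreal ((1/2) ^ j) * 1 + ennreal (2 ^ j) * nsq unit_square (D j) \<le>
        ennreal ((1/2) ^ j) * 1 + ennreal (2 ^ j) * ennreal ((1/4) ^ j)"
      by (intro add_left_mono mult_left_mono nsqD) auto
    also have "\<dots> = ennreal ((1/2) ^ j + 2 ^ j * (1/4) ^ j)"
      by (simp flip: ennreal_plus ennreal_mult)
    also have "2 ^ j * (1/4) ^ j = (1/2 :: real) ^ j" by (simp flip: power_mult_distrib)
    finally show ?thesis by (simp only: mult_2)
  qed
  have "(\<integral>\<^sup>+z. (\<Sum>j. ennreal (cmod (D j z))) \<partial>unit_square) = (\<Sum>j. \<integral>\<^sup>+z. ennreal (cmod (D j z)) \<partial>unit_square)"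
    by (rule nn_integral_suminf) simp
  also have "\<dots> \<le> (\<Sum>j. ennreal (2 * (1/2) ^ j))"
    by (intro suminf_le L1) auto
  also have "\<dots> = ennreal (\<Sum>j. 2 * (1/2) ^ j)"
    by (intro suminf_ennreal_eq summable_sums summable_mult summable_geometric) auto
  finally have "(\<integral>\<^sup>+z. (\<Sum>j. ennreal (cmod (D j z))) \<partial>unit_square) \<noteq> \<infinity>"
    by (auto simp: top_unique)
  then have "AE z in unit_square. (\<Sum>j. ennreal (cmod (D j z))) \<noteq> \<infinity>"
    by (intro nn_integral_PInf_AE) auto
  then have conv: "AE z in unit_square. convergent (\<lambda>j. S (N j) z)"
  proof eventually_elim
    case (elim z)
    then have "summable (\<lambda>j. cmod (D j z))"
      by (intro summable_suminf_not_top) auto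
    then have "summable (\<lambda>j. D j z)" by (rule summable_norm_cancel)
    then have "convergent (\<lambda>n. \<Sum>j<n. D j z)" by (simp add: summable_iff_convergent)
    also have "(\<lambda>n. \<Sum>j<n. D j z) = (\<lambda>n. S (N n) z - S (N 0) z)"
      unfolding D_def by (simp add: sum_lessThan_telescope[of "\<lambda>j. S (N j) z"])
    finally have "convergent (\<lambda>n. S (N n) z - S (N 0) z)" .
    from convergent_add[OF this convergent_const[of "S (N 0) z"]] show ?case by simp
  qed
  \<comment> \<open>Where the sequence diverges \<open>lim\<close> is a fixed unspecified value;
    \<open>u\<close> remains Borel and this happens only on a null set.\<close>
  define u where "u z = lim (\<lambda>j. S (N j) z)" for z
  have u[measurable]: "u \<in> borel_measurable borel" unfolding u_def by measurable
  have ae1: "AE y in I01. AE x in I01. (\<lambda>j. S (N j) (x, y)) \<longlonglongrightarrow> u (x, y)"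
    using AE_unit_square_slices[OF conv] by (simp add: convergent_LIMSEQ_iff u_def)
  have ae2: "AE y in I01. (\<Sum>k. ennreal ((cmod (b y k))\<^sup>2)) \<noteq> \<infinity>"
    using int by (intro nn_integral_PInf_AE) auto
  have "zak u v" unfolding zak_def
  proof (intro conjI)
    show "AE y in I01. nsq I01 (\<lambda>x. u (x, y)) < \<infinity> \<and> (\<forall>n. v (y + of_int n) = fc (\<lambda>x. u (x, y)) n)"
      using ae1 ae2
    proof eventually_elim
      case (elim y)
      have "summable (\<lambda>k. (cmod (b y k))\<^sup>2)"
        using elim by (intro summable_suminf_not_top) auto
      moreover have "AE x in I01. (\<lambda>j. \<Sum>k<N j. b y k * chr (of_int (int_decode k) * x)) \<longlonglongrightarrow> u (x, y)"
        using elim by (simp add: S_def)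
      ultimately have *: "nsq I01 (\<lambda>x. u (x, y)) < \<infinity> \<and> (\<forall>k. fc (\<lambda>x. u (x, y)) (int_decode k) = b y k)"
        using N_ge by (intro fourier_series_subsequence_limit[where N=N] measurable_slice) auto
      have "v (y + of_int n) = fc (\<lambda>x. u (x, y)) n" for n
        using *[THEN conjunct2, rule_format, of "int_encode n"] by (simp add: b_def)
      with * show ?case by blast
    qed
  qed measurable
  then show thesis by (rule that)
qed

section \<open>Gabor systems as trigonometric multiples of one Zak transform\<close>

abbreviation (input) gabor :: "(real \<Rightarrow> complex) \<Rightarrow> int \<times> int \<Rightarrow> real \<Rightarrow> complex" where
  "gabor g \<equiv> \<lambda>(m, n). modul (of_int m) (transl (of_int n) g)"

lemma zak_trig_poly_mult:
  assumes "zak f g" and "trig_poly p"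
  shows "\<exists>s\<in>lin_span (gabor g). zak (\<lambda>z. p z * f z) s"
  using assms(2)
proof (induction rule: trig_poly.induct)
  case (char k m)
  \<comment> \<open>The frequency in \<open>x\<close> is the translation and the frequency in
    \<open>y\<close> the modulation, hence the swapped index.\<close>
  have "gabor g (m, k) \<in> lin_span (gabor g)" by (rule lin_span_base)
  then show ?case using zak_modul_transl[OF assms(1), of k m] by auto
next
  case (add p p')
  then obtain s s' where s: "s \<in> lin_span (gabor g)" "zak (\<lambda>z. p z * f z) s"
    "s' \<in> lin_span (gabor g)" "zak (\<lambda>z. p' z * f z) s'" by blast
  then show ?case
    using zak_add[of _ s _ s'] lin_span_add by (intro bexI[of _ "\<lambda>t. s t + s' t"]) (auto simp: distrib_right)
next
  case (cmult p c)
  then obtain s where s: "s \<in> lin_span (gabor g)" "zak (\<lambda>z. p z * f z) s" by blast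
  then show ?case
    using zak_cmult[of _ s c] lin_span_cmult by (intro bexI[of _ "\<lambda>t. c * s t"]) (auto simp: mult.assoc)
qed

text \<open>Only the product form is recorded: the application needs no more than that
  \<open>p z * f z\<close> vanishes where \<open>f z\<close> does.\<close>

lemma zak_lin_span:
  assumes "zak f g" and "s \<in> lin_span (gabor g)"
  shows "\<exists>p. zak (\<lambda>z. p z * f z) s"
  using assms(2)
proof (induction rule: lin_span_induct)
  case zero
  show ?case using zak_zero by (intro exI[of _ "\<lambda>_. 0"]) simp
next
  case (add h a i)
  then obtain p where p: "zak (\<lambda>z. p z * f z) h" by blast
  obtain m n where i: "i = (m, n)" by (cases i)
  from zak_add[OF zak_cmult[OF zak_modul_transl[OF assms(1), of n m], of a] p]
  show ?case unfolding i
    by (intro exI[of _ "\<lambda>z. a * (case z of (x, y) \<Rightarrow> chr (of_int n * x) * chr (of_int m * y)) + p z"])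
      (simp add: distrib_right mult.assoc)
qed

lemma gabor_span_dense:
  fixes \<epsilon> :: ennreal
  assumes zak: "zak f g" and nz: "AE z in unit_square. f z \<noteq> 0"
    and h[measurable]: "h \<in> borel_measurable borel" and fin: "nsq lborel h < \<infinity>" and "\<epsilon> > 0"
    and g: "nsq lborel g < \<infinity>"
  shows "\<exists>s\<in>lin_span (gabor g). nsq lborel (\<lambda>x. h x - s x) < \<epsilon>"
proof -
  have [measurable]: "f \<in> borel_measurable borel" using zak by (simp add: zak_def)
  obtain u where u: "zak u h" using zak_exists[OF h fin] .
  have [measurable]: "u \<in> borel_measurable borel" using u by (simp add: zak_def)
  define N where "N = density unit_square (\<lambda>z. ennreal ((cmod (f z))\<^sup>2))"
  have sets: "sets N = sets borel" unfolding N_def sets_density by (rule sets_unit_square)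
  have nsqN: "nsq N q = nsq unit_square (\<lambda>z. q z * f z)" if [measurable]: "q \<in> borel_measurable borel" for q
    unfolding nsq_def N_def
    by (subst nn_integral_density) (auto simp: norm_mult power_mult_distrib ennreal_mult mult.commute)
  \<comment> \<open>Division by \<open>f\<close> is undone almost everywhere; this is where
    \<open>f \<noteq> 0\<close> a.e. enters.\<close>
  have cancel: "nsq unit_square (\<lambda>z. (u z / f z - p z) * f z) = nsq unit_square (\<lambda>z. u z - p z * f z)" for p
    unfolding nsq_def using nz by (intro nn_integral_cong_AE) (auto simp: left_diff_distrib)
  have "\<exists>p. trig_poly p \<and> nsq N (\<lambda>z. u z / f z - p z) < \<epsilon>"
  proof (rule trig_poly_dense[OF _ sets])
    have top: "UNIV \<in> sets unit_square" using sets.top[of unit_square] by (simp only: space_unit_square)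
    \<comment> \<open>The total mass of the weight is the squared norm of \<open>g\<close>, so the
      weighted measure is finite because \<open>g\<close> is in L^2.\<close>
    have "emeasure N (space N) = nsq unit_square f"
      unfolding nsq_def N_def space_density space_unit_square by (subst emeasure_density[OF _ top]) auto
    also have "\<dots> < \<infinity>" using g zak_isometry[OF zak] by simp
    finally show "finite_measure N" by (intro finite_measureI) simp
    have "AE x in I01. x \<in> {0..<1}"
      unfolding AE_I01 using AE_lborel_singleton[of 1] by eventually_elim auto
    then have "AE x in I01. AE y in I01. x \<in> {0..<1} \<and> y \<in> {0..<1}"
      by auto
    then have "AE z in unit_square. fst z \<in> {0..<1} \<and> snd z \<in> {0..<1}"
    proof (subst (asm) I01_pair.AE_pair_iff)
      have "{z \<in> space (borel \<Otimes>\<^sub>M borel). fst z \<in> {0..<1::real} \<and> snd z \<in> {0..<1::real}} \<in> sets (borel \<Otimes>\<^sub>M borel)"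
        by measurable
      then show "{z \<in> space unit_square. fst z \<in> {0..<1} \<and> snd z \<in> {0..<1}} \<in> sets unit_square"
        by (simp only: sets_unit_square borel_prod space_unit_square space_borel)
    qed
    then show "AE z in N. fst z \<in> {0..<1} \<and> snd z \<in> {0..<1}"
      unfolding N_def by (subst AE_density) auto
    \<comment> \<open>With \<open>p = 0\<close>, \<open>cancel\<close> equates the weighted norm of
      \<open>u / f\<close> with the norm of \<open>u\<close>, hence with that of
      \<open>h\<close>.\<close>
    show "nsq N (\<lambda>z. u z / f z) < \<infinity>"
      using cancel[of "\<lambda>_. 0"] zak_isometry[OF u] fin by (simp add: nsqN)
  qed (use \<open>\<epsilon> > 0\<close> in auto)
  then obtain p where p: "trig_poly p" "nsq N (\<lambda>z. u z / f z - p z) < \<epsilon>" by blast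
  have [measurable]: "p \<in> borel_measurable borel" using p(1) by (rule measurable_trig_poly)
  obtain s where s: "s \<in> lin_span (gabor g)" "zak (\<lambda>z. p z * f z) s"
    using zak_trig_poly_mult[OF zak p(1)] by blast
  have "nsq lborel (\<lambda>x. h x - s x) = nsq unit_square (\<lambda>z. u z - p z * f z)"
    by (rule zak_isometry[OF zak_diff[OF u s(2)]])
  also have "\<dots> = nsq N (\<lambda>z. u z / f z - p z)" by (simp add: nsqN cancel)
  finally show ?thesis using p(2) s(1) by (intro bexI[of _ s]) simp_all
qed

lemma zak_nonzero_if_dense:
  assumes zak: "zak f g"
    and dense: "\<And>h \<epsilon>. h \<in> borel_measurable borel \<Longrightarrow> nsq lborel h < \<infinity> \<Longrightarrow> \<epsilon> > 0 \<Longrightarrow>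
      \<exists>s\<in>lin_span (gabor g). nsq lborel (\<lambda>x. h x - s x) < \<epsilon>"
  shows "AE z in unit_square. f z \<noteq> 0"
proof -
  have f[measurable]: "f \<in> borel_measurable borel" using zak by (simp add: zak_def)
  define w :: "real \<times> real \<Rightarrow> complex" where "w z = (if f z = 0 then 1 else 0)" for z
  have w[measurable]: "w \<in> borel_measurable borel" unfolding w_def by measurable
  \<comment> \<open>The explicit inverse Zak transform of \<open>w\<close>: on
    \<open>[n, n+1)\<close> it is the \<open>n\<close>-th coefficient of the slice at the fractional
    part. As a parametrised integral it is measurable.\<close>
  define h where "h t = fc (\<lambda>x. w (x, t - of_int \<lfloor>t\<rfloor>)) \<lfloor>t\<rfloor>" for t
  have h[measurable]: "h \<in> borel_measurable borel"
  proof -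
    have [measurable]: "w \<in> borel_measurable (borel \<Otimes>\<^sub>M borel)" using w by (simp add: borel_prod)
    have "(\<lambda>(t, x). w (x, t - of_int \<lfloor>t\<rfloor>) * chr (- (of_int \<lfloor>t\<rfloor> * x))) \<in> borel_measurable (borel \<Otimes>\<^sub>M borel)"
      by measurable
    then have "(\<lambda>(t, x). w (x, t - of_int \<lfloor>t\<rfloor>) * chr (- (of_int \<lfloor>t\<rfloor> * x))) \<in> borel_measurable (borel \<Otimes>\<^sub>M I01)"
      by (simp cong: measurable_cong_sets sets_pair_measure_cong)
    then show ?thesis unfolding h_def fc_def by (rule I01.borel_measurable_lebesgue_integral)
  qed
  have nsq_le: "nsq I01 (\<lambda>x. w (x, y)) < \<infinity>" for y
  proof -
    have "nsq I01 (\<lambda>x. w (x, y)) \<le> nsq I01 (\<lambda>_. 1)"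
      unfolding nsq_def by (intro nn_integral_mono ennreal_leI) (auto simp: w_def)
    then show ?thesis by (simp add: nsq_def emeasure_I01_UNIV order.strict_trans1)
  qed
  have zakw: "zak w h" unfolding zak_def
  proof (intro conjI)
    have "AE y in I01. 0 \<le> y \<and> y < 1"
      unfolding AE_I01 using AE_lborel_singleton[of 1] by eventually_elim auto
    then show "AE y in I01. nsq I01 (\<lambda>x. w (x, y)) < \<infinity> \<and> (\<forall>n. h (y + of_int n) = fc (\<lambda>x. w (x, y)) n)"
    proof eventually_elim
      case (elim y)
      then have "\<lfloor>y + of_int n\<rfloor> = n" for n by (simp add: floor_eq_iff)
      then show ?case using nsq_le by (simp add: h_def)
    qed
  qed measurable
  have finh: "nsq lborel h < \<infinity>"
  proof -
    have "nsq unit_square w \<le> nsq unit_square (\<lambda>_. 1)"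
      unfolding nsq_def by (intro nn_integral_mono ennreal_leI) (auto simp: w_def)
    also have "\<dots> < \<infinity>"
      using I01.emeasure_pair_measure_Times[of UNIV I01 UNIV] by (simp add: nsq_def emeasure_I01_UNIV)
    finally show ?thesis by (simp add: zak_isometry[OF zakw])
  qed
  have "nsq unit_square w = 0"
  proof (rule ccontr)
    assume "nsq unit_square w \<noteq> 0"
    then have "nsq unit_square w > 0" by (simp add: zero_less_iff_neq_zero)
    from dense[OF h finh this] obtain s where
      s: "s \<in> lin_span (gabor g)" "nsq lborel (\<lambda>x. h x - s x) < nsq unit_square w" by blast
    obtain p where p: "zak (\<lambda>z. p z * f z) s" using zak_lin_span[OF zak s(1)] by blast
    \<comment> \<open>Where \<open>w\<close> is nonzero \<open>f\<close> vanishes, so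
      \<open>w - p f\<close> equals \<open>w\<close> there; no product \<open>p f\<close> comes
      closer to \<open>w\<close> than the zero function.\<close>
    have "nsq unit_square w \<le> nsq unit_square (\<lambda>z. w z - p z * f z)"
      unfolding nsq_def by (intro nn_integral_mono ennreal_leI) (auto simp: w_def)
    also have "\<dots> = nsq lborel (\<lambda>x. h x - s x)"
      by (rule zak_isometry[OF zak_diff[OF zakw p], symmetric])
    finally show False using s(2) by simp
  qed
  then have "AE z in unit_square. ennreal ((cmod (w z))\<^sup>2) = 0"
    unfolding nsq_def by (subst (asm) nn_integral_0_iff_AE) auto
  then show ?thesis by eventually_elim (auto simp: w_def)
qed

section \<open>Lebesgue measurable representatives\<close>

lemma nsq_cong_AE: "(AE x in M. f x = h x) \<Longrightarrow> nsq M f = nsq M h"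
  unfolding nsq_def by (intro nn_integral_cong_AE) auto

lemma L2_iff: "f \<in> L2 M \<longleftrightarrow> f \<in> borel_measurable M \<and> nsq M f < \<infinity>"
  unfolding L2_def nsq_def by (auto simp: integrable_iff_bounded)

lemma L2_diff: "f \<in> L2 M \<Longrightarrow> h \<in> L2 M \<Longrightarrow> (\<lambda>x. f x - h x) \<in> L2 M"
  unfolding L2_iff using nsq_diff[of f M h]
  by (auto intro: order.strict_trans1 simp: ennreal_mult_less_top)

lemma lin_span_L2:
  assumes "range F \<subseteq> L2 M" and "h \<in> lin_span F"
  shows "h \<in> L2 M"
  using assms(2)
proof (induction rule: lin_span_induct)
  case zero
  show ?case by (simp add: L2_iff nsq_def)
next
  case (add h a i)
  have Fi: "F i \<in> L2 M" using assms(1) by auto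
  have [measurable]: "F i \<in> borel_measurable M" "h \<in> borel_measurable M"
    using add Fi by (auto simp: L2_iff)
  have "nsq M (\<lambda>x. a * F i x + h x) \<le> 2 * nsq M (\<lambda>x. a * F i x) + 2 * nsq M h"
    by (rule nsq_add) measurable
  also have "\<dots> < \<infinity>"
    using add Fi by (simp add: nsq_cmult ennreal_mult_less_top L2_iff)
  finally show ?case by (simp add: L2_iff)
qed

text \<open>Membership in \<open>L2 M\<close> keeps the two distances equal: for a difference
  without integrable square \<open>L2_dist\<close> would be 0 and \<open>nsq\<close>
  infinite.\<close>

lemma L2_dist_less_iff:
  assumes "f \<in> L2 M" "h \<in> L2 M" "\<epsilon> > 0"
  shows "L2_dist M f h < \<epsilon> \<longleftrightarrow> nsq M (\<lambda>x. f x - h x) < ennreal (\<epsilon>\<^sup>2)"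
proof -
  define I where "I = (LINT x|M. (cmod (f x - h x))\<^sup>2)"
  have "(\<lambda>x. f x - h x) \<in> L2 M" using assms by (intro L2_diff)
  then have nsq: "nsq M (\<lambda>x. f x - h x) = ennreal I"
    unfolding I_def by (intro nsq_eq_integral) (auto simp: L2_iff)
  have "L2_dist M f h < \<epsilon> \<longleftrightarrow> sqrt I < sqrt (\<epsilon>\<^sup>2)"
    using assms(3) by (simp add: L2_dist_def I_def)
  also have "\<dots> \<longleftrightarrow> I < \<epsilon>\<^sup>2" by (rule real_sqrt_less_iff)
  also have "\<dots> \<longleftrightarrow> ennreal I < ennreal (\<epsilon>\<^sup>2)"
    by (subst ennreal_less_iff) (auto simp: I_def)
  finally show ?thesis by (simp add: nsq)
qed

lemma complete_in_L2_iff: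
  "complete_in_L2 M F \<longleftrightarrow> range F \<subseteq> L2 M \<and>
    (\<forall>h\<in>L2 M. \<forall>\<epsilon>>0. \<exists>s\<in>lin_span F. nsq M (\<lambda>x. h x - s x) < \<epsilon>)"
proof (cases "range F \<subseteq> L2 M")
  case True
  have dist: "L2_dist M h s < \<epsilon> \<longleftrightarrow> nsq M (\<lambda>x. h x - s x) < ennreal (\<epsilon>\<^sup>2)"
    if "h \<in> L2 M" "s \<in> lin_span F" "\<epsilon> > 0" for h s \<epsilon>
    using that lin_span_L2[OF True] by (intro L2_dist_less_iff) auto
  have "L2_closed_span M F = {h \<in> L2 M. \<forall>\<epsilon>>0. \<exists>s\<in>lin_span F. L2_dist M h s < \<epsilon>}"
    unfolding L2_closed_span_def bex_lin_span_iff ..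
  then have "complete_in_L2 M F \<longleftrightarrow> (\<forall>h\<in>L2 M. \<forall>\<epsilon>>0. \<exists>s\<in>lin_span F. L2_dist M h s < \<epsilon>)"
    using True unfolding complete_in_L2_def set_eq_iff mem_Collect_eq by blast
  also have "\<dots> \<longleftrightarrow> (\<forall>h\<in>L2 M. \<forall>\<epsilon>>0. \<exists>s\<in>lin_span F. nsq M (\<lambda>x. h x - s x) < \<epsilon>)"
  proof (intro ball_cong refl iffI allI impI)
    fix h and \<epsilon> :: ennreal
    assume h: "h \<in> L2 M" and ap: "\<forall>\<epsilon>>0. \<exists>s\<in>lin_span F. L2_dist M h s < \<epsilon>" and "\<epsilon> > 0"
    \<comment> \<open>\<open>\<epsilon>\<close> may be infinite here; then any positive radius
      serves.\<close>
    have "\<exists>\<delta>>0. ennreal (\<delta>\<^sup>2) \<le> \<epsilon>"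
    proof (cases \<epsilon>)
      case (real r)
      then show ?thesis using \<open>\<epsilon> > 0\<close> by (intro exI[of _ "sqrt r"]) auto
    next
      case top
      then show ?thesis by (intro exI[of _ 1]) auto
    qed
    then obtain \<delta> where "\<delta> > 0" "ennreal (\<delta>\<^sup>2) \<le> \<epsilon>" by blast
    with ap h dist show "\<exists>s\<in>lin_span F. nsq M (\<lambda>x. h x - s x) < \<epsilon>"
      by (meson order.strict_trans2)
  next
    fix h and \<epsilon> :: real
    assume h: "h \<in> L2 M" and ap: "\<forall>\<epsilon>>0. \<exists>s\<in>lin_span F. nsq M (\<lambda>x. h x - s x) < \<epsilon>" and "\<epsilon> > 0"
    then have "ennreal (\<epsilon>\<^sup>2) > 0" by simp
    with ap obtain s where "s \<in> lin_span F" "nsq M (\<lambda>x. h x - s x) < ennreal (\<epsilon>\<^sup>2)" by blast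
    then show "\<exists>s\<in>lin_span F. L2_dist M h s < \<epsilon>" using dist[OF h _ \<open>\<epsilon> > 0\<close>] by blast
  qed
  finally show ?thesis using True by simp
qed (simp add: complete_in_L2_def)

lemma nsq_lebesgue: "nsq lebesgue h = nsq lborel h"
  unfolding nsq_def by (rule nn_integral_completion)

lemma ex_borel_version:
  fixes h :: "'a::euclidean_space \<Rightarrow> complex"
  assumes [measurable]: "h \<in> borel_measurable lebesgue"
  obtains h' where "h' \<in> borel_measurable borel" "AE x in lborel. h x = h' x"
proof -
  obtain r where r: "r \<in> borel_measurable lborel" "AE x in lborel. Re (h x) = r x"
    using completion_ex_borel_measurable_real[of "\<lambda>x. Re (h x)" lborel] by auto
  obtain i where i: "i \<in> borel_measurable lborel" "AE x in lborel. Im (h x) = i x"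
    using completion_ex_borel_measurable_real[of "\<lambda>x. Im (h x)" lborel] by auto
  have [measurable]: "r \<in> borel_measurable borel" "i \<in> borel_measurable borel" using r i by auto
  show thesis
  proof (rule that)
    show "(\<lambda>x. of_real (r x) + \<i> * of_real (i x)) \<in> borel_measurable borel" by measurable
    show "AE x in lborel. h x = of_real (r x) + \<i> * of_real (i x)"
      using r(2) i(2) by eventually_elim (simp add: complex_eq_iff)
  qed
qed

text \<open>A single null set serves all indices, so whole linear combinations can be exchanged at
  once.\<close>

lemma gabor_AE_cong:
  assumes "AE x in lborel. g x = g' x"
  shows "AE x in lborel. \<forall>i. gabor g i x = gabor g' i x"
  using AE_lborel_translates[OF assms]
proof eventually_elim
  case (elim x)
  have "g (x - of_int n) = g' (x - of_int n)" for n
    using elim[rule_format, of "- n"] by simp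
  then show ?case by (auto simp: modul_def transl_def)
qed

text \<open>Completeness depends only on a.e. classes: the generator \<open>g\<close> and every
  target \<open>h\<close> may be replaced by Borel versions, with the same coefficients in the
  approximating sums.\<close>

lemma complete_gabor_iff:
  assumes g': "g' \<in> borel_measurable borel" "nsq lborel g' < \<infinity>"
    and eq: "AE x in lborel. g x = g' x"
  shows "complete_in_L2 lebesgue (gabor g) \<longleftrightarrow>
    (\<forall>h \<epsilon>. h \<in> borel_measurable borel \<longrightarrow> nsq lborel h < \<infinity> \<longrightarrow> \<epsilon> > 0 \<longrightarrow>
      (\<exists>s\<in>lin_span (gabor g'). nsq lborel (\<lambda>x. h x - s x) < \<epsilon>))"
proof -
  note [measurable] = g'(1)
  have ae: "AE x in lborel. \<forall>i. gabor g i x = gabor g' i x" by (rule gabor_AE_cong[OF eq])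
  have gabor'[measurable]: "gabor g' i \<in> borel_measurable borel" for i
    by (cases i) (simp add: modul_eq_chr[abs_def] transl_def)
  have "gabor g i \<in> L2 lebesgue" for i
  proof -
    obtain m n where i: "i = (m, n)" by (cases i)
    have aei: "AE x in lborel. gabor g' i x = gabor g i x" using ae by eventually_elim metis
    have "gabor g' i \<in> borel_measurable lebesgue" by (intro measurable_completion) simp
    then have m: "gabor g i \<in> borel_measurable lebesgue"
      by (rule borel_measurable_AE) (use aei in \<open>simp add: AE_completion_iff\<close>)
    have "nsq lborel (gabor g i) = nsq lborel (gabor g' i)"
      by (rule nsq_cong_AE) (use aei in \<open>auto simp: eq_commute\<close>)
    also have "\<dots> = (\<integral>\<^sup>+x. ennreal ((cmod (g' (- of_int n + 1 * x)))\<^sup>2) \<partial>lborel)"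
      by (simp add: nsq_def i modul_eq_chr transl_def norm_mult)
    also have "\<dots> = nsq lborel g'"
      unfolding nsq_def
      by (subst nn_integral_real_affine[where f="\<lambda>x. ennreal ((cmod (g' x))\<^sup>2)" and c=1 and t="- of_int n"]) auto
    finally show ?thesis using m g' by (simp add: L2_iff nsq_lebesgue)
  qed
  then have range: "range (gabor g) \<subseteq> L2 lebesgue" by auto
  have sum_eq: "nsq lborel (\<lambda>x. h x - (\<Sum>i\<in>I. c i * gabor g i x)) = nsq lborel (\<lambda>x. h' x - (\<Sum>i\<in>I. c i * gabor g' i x))"
    if "AE x in lborel. h x = h' x" for h h' and I :: "(int \<times> int) set" and c
    using that ae by (intro nsq_cong_AE, eventually_elim) (simp only:)
  have span: "(\<exists>s\<in>lin_span (gabor g). nsq lborel (\<lambda>x. h x - s x) < \<epsilon>) \<longleftrightarrow>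
      (\<exists>s\<in>lin_span (gabor g'). nsq lborel (\<lambda>x. h' x - s x) < \<epsilon>)"
    if "AE x in lborel. h x = h' x" for h h' \<epsilon>
    unfolding bex_lin_span_iff sum_eq[OF that] ..
  show ?thesis unfolding complete_in_L2_iff nsq_lebesgue
  proof (intro iffI conjI allI impI ballI range)
    fix h :: "real \<Rightarrow> complex" and \<epsilon> :: ennreal
    assume *: "range (gabor g) \<subseteq> L2 lebesgue \<and>
       (\<forall>h\<in>L2 lebesgue. \<forall>\<epsilon>>0. \<exists>s\<in>lin_span (gabor g). nsq lborel (\<lambda>x. h x - s x) < \<epsilon>)"
      and h: "h \<in> borel_measurable borel" "nsq lborel h < \<infinity>" and "\<epsilon> > 0"
    have "h \<in> L2 lebesgue" using h by (auto simp: L2_iff nsq_lebesgue intro!: measurable_completion)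
    then show "\<exists>s\<in>lin_span (gabor g'). nsq lborel (\<lambda>x. h x - s x) < \<epsilon>"
      using * \<open>\<epsilon> > 0\<close> span[of h h] by auto
  next
    fix h :: "real \<Rightarrow> complex" and \<epsilon> :: ennreal
    assume *: "\<forall>h \<epsilon>. h \<in> borel_measurable borel \<longrightarrow> nsq lborel h < \<infinity> \<longrightarrow> \<epsilon> > 0 \<longrightarrow>
      (\<exists>s\<in>lin_span (gabor g'). nsq lborel (\<lambda>x. h x - s x) < \<epsilon>)"
      and h: "h \<in> L2 lebesgue" and "\<epsilon> > 0"
    obtain h' where h': "h' \<in> borel_measurable borel" "AE x in lborel. h x = h' x"
      using ex_borel_version h by (auto simp: L2_iff)
    have "nsq lborel h' < \<infinity>" using h nsq_cong_AE[OF h'(2)] by (simp add: L2_iff nsq_lebesgue)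
    then show "\<exists>s\<in>lin_span (gabor g). nsq lborel (\<lambda>x. h x - s x) < \<epsilon>"
      using * h'(1) \<open>\<epsilon> > 0\<close> span[OF h'(2)] by blast
  qed
qed

section \<open>Lebesgue and Borel versions of the unit interval\<close>

lemma AE_lebesgue_on_unit_interval:
  "(AE y in lebesgue_on {0..1}. P y) \<longleftrightarrow> (AE y in I01. P y)"
  by (subst AE_restrict_space_iff) (auto simp: AE_completion_iff AE_I01)

lemma nsq_lebesgue_on_unit_interval:
  assumes [measurable]: "u' \<in> borel_measurable borel" and eq: "AE x in I01. u x = u' x"
  shows "nsq (lebesgue_on {0..1}) u = nsq I01 u'"
proof -
  have "nsq (lebesgue_on {0..1}) u = nsq (lebesgue_on {0..1}) u'"
    by (rule nsq_cong_AE) (use eq in \<open>simp add: AE_lebesgue_on_unit_interval\<close>)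
  also have "\<dots> = nsq I01 u'"
    unfolding nsq_def by (simp add: nn_integral_restrict_space nn_integral_completion nn_integral_I01)
  finally show ?thesis .
qed

lemma borel_measurable_lebesgue_on:
  "u \<in> borel_measurable borel \<Longrightarrow> u \<in> borel_measurable (lebesgue_on S)"
  by (intro measurable_restrict_space1 measurable_completion) simp

lemma fourier_coeff_eq_fc:
  assumes [measurable]: "u' \<in> borel_measurable borel" "u \<in> borel_measurable (lebesgue_on {0..1})"
    and eq: "AE x in I01. u x = u' x"
  shows "fourier_coeff u n = fc u' n"
proof -
  have e: "exp (- (2 * of_real pi * \<i> * of_int n * of_real x)) = chr (- (of_int n * x))" for x
    by (simp add: chr_def mult.assoc)
  have [measurable]: "(\<lambda>x. chr (- (of_int n * x))) \<in> borel_measurable (lebesgue_on {0..1})"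
    "u' \<in> borel_measurable (lebesgue_on {0..1})"
    by (rule borel_measurable_lebesgue_on, measurable)+
  have "fourier_coeff u n = (LINT x|lebesgue_on {0..1}. u' x * chr (- (of_int n * x)))"
    unfolding fourier_coeff_def e
    by (rule integral_cong_AE) (use eq in \<open>auto simp: AE_lebesgue_on_unit_interval\<close>)
  also have "\<dots> = (LINT x|lebesgue. indicator {0..1} x *\<^sub>R (u' x * chr (- (of_int n * x))))"
    by (rule integral_restrict_space) simp
  also have "\<dots> = (LINT x|lborel. indicator {0..1} x *\<^sub>R (u' x * chr (- (of_int n * x))))"
    by (rule integral_completion) measurable
  also have "\<dots> = fc u' n"
    unfolding fc_def by (rule integral_I01[symmetric]) measurable
  finally show ?thesis .
qed

lemma lborel_prod_slices:
  assumes "AE z in (lborel :: (real \<times> real) measure). P z"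
  shows "AE y in lborel. AE x in lborel. P (x, y)"
proof -
  have "AE z in distr (lborel \<Otimes>\<^sub>M lborel) (lborel \<Otimes>\<^sub>M lborel) (\<lambda>(x, y). (y, x)). P z"
    using assms lborel_pair.distr_pair_swap lborel_prod by metis
  then have "AE z in lborel \<Otimes>\<^sub>M lborel. P (case z of (x, y) \<Rightarrow> (y, x))"
    by (rule AE_distrD[OF measurable_pair_swap'])
  from lborel_pair.AE_pair[OF this] show ?thesis by simp
qed

theorem theorem7p5:
  fixes g :: "real \<Rightarrow> complex"
  assumes "g \<in> L2 lebesgue"
  shows "complete_in_L2 lebesgue
           (\<lambda>(m::int, n::int). modul (of_int m) (transl (of_int n) g)) \<longleftrightarrow>
         (\<exists>f :: real \<times> real \<Rightarrow> complex.
            f \<in> borel_measurable (lebesgue_on ({0..1} \<times> {0..1})) \<and>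
            (AE y in lebesgue_on {0..1}. (\<lambda>x. f (x, y)) \<in> L2 (lebesgue_on {0..1})) \<and>
            (AE y in lebesgue_on {0..1}. AE x in lebesgue_on {0..1}. f (x, y) \<noteq> 0) \<and>
            (AE y in lebesgue_on {0..1}. \<forall>n::int.
               g (y + of_int n) = fourier_coeff (\<lambda>x. f (x, y)) n))"
    (is "?complete \<longleftrightarrow> (\<exists>f. ?P f)")
proof -
  obtain g' where g'[measurable]: "g' \<in> borel_measurable borel" and eq: "AE x in lborel. g x = g' x"
    using ex_borel_version assms by (auto simp: L2_iff)
  have fin: "nsq lborel g' < \<infinity>"
    using assms nsq_cong_AE[OF eq] by (simp add: L2_iff nsq_lebesgue)
  \<comment> \<open>Passing from \<open>g\<close> to \<open>g'\<close> disturbs the samples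
    \<open>y + n\<close> only for a null set of \<open>y\<close>.\<close>
  have eqn: "AE y in I01. \<forall>n::int. g (y + of_int n) = g' (y + of_int n)"
    using AE_lborel_translates[OF eq] unfolding AE_I01 by eventually_elim simp
  note complete_iff = complete_gabor_iff[OF g' fin eq]
  show ?thesis
  proof
    assume ?complete
    obtain f where zak: "zak f g'" using zak_exists[OF g' fin] .
    have f[measurable]: "f \<in> borel_measurable borel" using zak by (simp add: zak_def)
    have slice: "(\<lambda>x. f (x, y)) \<in> borel_measurable borel" for y by (rule measurable_slice[OF f])
    have coeff: "fourier_coeff (\<lambda>x. f (x, y)) n = fc (\<lambda>x. f (x, y)) n" for y n
      by (rule fourier_coeff_eq_fc[OF slice borel_measurable_lebesgue_on[OF slice]]) simp
    have nz: "AE z in unit_square. f z \<noteq> 0"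
      by (rule zak_nonzero_if_dense[OF zak]) (use \<open>?complete\<close> in \<open>simp add: complete_iff\<close>)
    have ae: "AE y in I01. nsq I01 (\<lambda>x. f (x, y)) < \<infinity> \<and> (\<forall>n. g' (y + of_int n) = fc (\<lambda>x. f (x, y)) n)"
      using zak by (simp add: zak_def)
    have "?P f"
      unfolding AE_lebesgue_on_unit_interval
    proof (intro conjI)
      show "f \<in> borel_measurable (lebesgue_on ({0..1} \<times> {0..1}))"
        by (rule borel_measurable_lebesgue_on[OF f])
      show "AE y in I01. (\<lambda>x. f (x, y)) \<in> L2 (lebesgue_on {0..1})"
        using ae
      proof eventually_elim
        case (elim y)
        have "nsq (lebesgue_on {0..1}) (\<lambda>x. f (x, y)) = nsq I01 (\<lambda>x. f (x, y))"
          by (rule nsq_lebesgue_on_unit_interval[OF slice]) simp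
        then show ?case using elim by (simp add: L2_iff borel_measurable_lebesgue_on[OF slice])
      qed
      show "AE y in I01. AE x in I01. f (x, y) \<noteq> 0"
        by (rule AE_unit_square_slices[OF nz])
      show "AE y in I01. \<forall>n::int. g (y + of_int n) = fourier_coeff (\<lambda>x. f (x, y)) n"
        using ae eqn by eventually_elim (simp add: coeff)
    qed
    then show "\<exists>f. ?P f" by blast
  next
    assume "\<exists>f. ?P f"
    then obtain f where f: "f \<in> borel_measurable (lebesgue_on ({0..1} \<times> {0..1}))"
      and fL2: "AE y in I01. (\<lambda>x. f (x, y)) \<in> L2 (lebesgue_on {0..1})"
      and fnz: "AE y in I01. AE x in I01. f (x, y) \<noteq> 0"
      and fg: "AE y in I01. \<forall>n::int. g (y + of_int n) = fourier_coeff (\<lambda>x. f (x, y)) n"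
      unfolding AE_lebesgue_on_unit_interval by blast
    have "{0..1::real} \<times> {0..1::real} \<in> sets lebesgue"
      by (intro sets_completionI_sets) (simp add: borel_closed closed_Times)
    \<comment> \<open>Extension by zero makes \<open>f\<close> a Lebesgue measurable function on the
      plane, where \<open>ex_borel_version\<close> applies.\<close>
    then have "(\<lambda>z. indicator ({0..1} \<times> {0..1}) z *\<^sub>R f z) \<in> borel_measurable lebesgue"
      using f by (subst (asm) borel_measurable_restrict_space_iff) auto
    then obtain f' where f'[measurable]: "f' \<in> borel_measurable borel"
      and ff': "AE z in lborel. indicator ({0..1} \<times> {0..1}) z *\<^sub>R f z = f' z"
      by (rule ex_borel_version)
    have slice: "(\<lambda>x. f' (x, y)) \<in> borel_measurable borel" for y by (rule measurable_slice[OF f'])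
    have ae: "AE y in I01. AE x in I01. f (x, y) = f' (x, y)"
      unfolding AE_I01 using lborel_prod_slices[OF ff']
    proof eventually_elim
      case (elim y)
      show ?case
      proof
        assume y: "y \<in> {0..1}"
        show "AE x in lborel. x \<in> {0..1} \<longrightarrow> f (x, y) = f' (x, y)"
          using elim by eventually_elim (use y in auto)
      qed
    qed
    \<comment> \<open>For a.e. \<open>y\<close> the slices of \<open>f\<close> and \<open>f'\<close>
      agree a.e., so slice norms and Fourier coefficients carry over to \<open>f'\<close>.\<close>
    have zak: "zak f' g'" unfolding zak_def
    proof (intro conjI f' g')
      show "AE y in I01. nsq I01 (\<lambda>x. f' (x, y)) < \<infinity> \<and> (\<forall>n. g' (y + of_int n) = fc (\<lambda>x. f' (x, y)) n)"
        using ae fL2 fg eqn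
      proof eventually_elim
        case (elim y)
        from elim(1,2) have "nsq I01 (\<lambda>x. f' (x, y)) < \<infinity>"
          using nsq_lebesgue_on_unit_interval[OF slice elim(1)] by (simp add: L2_iff)
        moreover have "fourier_coeff (\<lambda>x. f (x, y)) n = fc (\<lambda>x. f' (x, y)) n" for n
          using elim(1,2) by (intro fourier_coeff_eq_fc slice) (auto simp: L2_iff)
        ultimately show ?case using elim(3,4) by metis
      qed
    qed
    have "AE y in I01. AE x in I01. f' (x, y) \<noteq> 0"
      using ae fnz by eventually_elim (rule AE_mp, assumption, erule AE_mp, auto)
    then have nz: "AE z in unit_square. f' z \<noteq> 0"
    proof -
      \<comment> \<open>Measurability of this set permits exchanging the order of the two a.e.
        quantifiers and reading them on the square.\<close>
      have "{z \<in> space unit_square. f' (fst z, snd z) \<noteq> 0} \<in> sets unit_square"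
        unfolding sets_unit_square space_unit_square by simp
      from I01_pair.AE_commute[OF this] I01_pair.AE_pair_iff[OF this]
      show ?thesis using \<open>AE y in I01. AE x in I01. f' (x, y) \<noteq> 0\<close> by simp
    qed
    show ?complete
      unfolding complete_iff using gabor_span_dense[OF zak nz _ _ _ fin] by blast
  qed
qed

end
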